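(* Let $B$ be a commutative, unital $C^*$-algebra and suppose $T$ is a quasinilpotent $B$-valued circular element in a $B$-valued $C^*$-noncommutative probability space $(A,E)$. Take $Z=b+T$, where $b\in B$ is invertible. Then $Z$ is invertible and for all $n\in\mathbb{N}$ we have $$E\big((Z^n)^*Z^n\big)\ge(b^n)^*b^n$$ and $$E\big((Z^{-n})^*Z^{-n}\big)\ge(b^{-n})^*b^{-n}.$$
   Context: A $B$-valued $C^*$-noncommutative probability space is a pair $(A,E)$ where $A$ is a unital $C^*$-algebra containing a unital copy of $B$ and $E:A\to B$ is a conditional expectation. For $B$ commutative, $T\in A$ is a $B$-valued circular element if $E(T)=0$ and the only nonvanishing $B$-valued (noncrossing) cumulants of the pair $(T,T^* )$ are the second-order ones given by the completely positive maps $\alpha_{1,2}(b)=E(TbT^* )$ and $\alpha_{2,1}(b)=E(T^*bT)$ on $B$. Equivalently (moment-cumulant formula): for all $n\ge1$, $\epsilon(1),\ldots,\epsilon(n)\in\{1,*\}$ and $b_1,\ldots,b_n\in B$, $$E(T^{\epsilon(1)}b_1\cdots T^{\epsilon(n)}b_n)=\sum_{\substack{2\le j\le n\\ \epsilon(j)\ne\epsilon(1)}}\alpha\big(b_1E(T^{\epsilon(2)}b_2\cdots T^{\epsilon(j-1)}b_{j-1})\big)\,b_j\,E(T^{\epsilon(j+1)}b_{j+1}\cdots T^{\epsilon(n)}b_n),$$ where $\alpha=\alpha_{1,2}$ if $\epsilon(1)=1$, $\alpha=\alpha_{2,1}$ if $\epsilon(1)=*$, and $E$ of an empty product is $1$.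
   Formalization: The formal statement additionally assumes that the GNS representation of E restricted to the C*-algebra generated by B and T is faithful (true when E is faithful); without it Z = b+T can fail to be invertible. *)

theory Defs
  imports "HOL-Analysis.Analysis"
begin

text \<open>Unital (nonzero) complex C*-algebras. The distribution has no complex normed algebras, so the
  complex structure is added on top of the real one.\<close>

class cstar_algebra = real_normed_algebra_1 + complete_space +
  fixes scaleC :: "complex \<Rightarrow> 'a \<Rightarrow> 'a" (infixr "*\<^sub>C" 75)
    and star :: "'a \<Rightarrow> 'a"
  assumes scaleC_add_right: "c *\<^sub>C (x + y) = c *\<^sub>C x + c *\<^sub>C y"
    and scaleC_add_left: "(c + d) *\<^sub>C x = c *\<^sub>C x + d *\<^sub>C x"
    and scaleC_scaleC: "c *\<^sub>C d *\<^sub>C x = (c * d) *\<^sub>C x"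
    and scaleR_eq_scaleC: "scaleR r x = complex_of_real r *\<^sub>C x"
    and scaleC_mult_left: "(c *\<^sub>C x) * y = c *\<^sub>C (x * y)"
    and scaleC_mult_right: "x * (c *\<^sub>C y) = c *\<^sub>C (x * y)"
    and norm_scaleC: "norm (c *\<^sub>C x) = cmod c * norm x"
    and star_star: "star (star x) = x"
    and star_add: "star (x + y) = star x + star y"
    and star_mult: "star (x * y) = star y * star x"
    and star_scaleC: "star (c *\<^sub>C x) = cnj c *\<^sub>C star x"
    and cstar_identity: "norm (star x * x) = (norm x)\<^sup>2"

definition invertible_in :: "'a::ring_1 set \<Rightarrow> 'a \<Rightarrow> bool" where
  "invertible_in S x \<longleftrightarrow> x \<in> S \<and> (\<exists>y\<in>S. x * y = 1 \<and> y * x = 1)"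

definition ring_inv :: "'a::ring_1 \<Rightarrow> 'a" where
  "ring_inv x = (THE y. x * y = 1 \<and> y * x = 1)"

definition spectrum :: "'a::cstar_algebra \<Rightarrow> complex set" where
  "spectrum x = {c. \<not> invertible_in UNIV (c *\<^sub>C 1 - x)}"

definition quasinilpotent :: "'a::cstar_algebra \<Rightarrow> bool" where
  "quasinilpotent x \<longleftrightarrow> spectrum x = {0}"

definition unital_cstar_subalgebra :: "'a::cstar_algebra set \<Rightarrow> bool" where
  "unital_cstar_subalgebra S \<longleftrightarrow> closed S \<and> 1 \<in> S \<and>
     (\<forall>x\<in>S. \<forall>y\<in>S. x + y \<in> S \<and> x * y \<in> S) \<and>
     (\<forall>x\<in>S. star x \<in> S \<and> (\<forall>c. c *\<^sub>C x \<in> S))"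

definition cstar_generated :: "'a::cstar_algebra set \<Rightarrow> 'a set" where
  "cstar_generated X = \<Inter> {S. unital_cstar_subalgebra S \<and> X \<subseteq> S}"

text \<open>The order of the C*-algebra \<open>B\<close>: \<open>x \<le> y\<close> iff \<open>y - x\<close> is a positive element of \<open>B\<close>.\<close>

definition le_in :: "'a::cstar_algebra set \<Rightarrow> 'a \<Rightarrow> 'a \<Rightarrow> bool" where
  "le_in B x y \<longleftrightarrow> x \<in> B \<and> y \<in> B \<and> (\<exists>c\<in>B. y - x = star c * c)"

text \<open>Conditional expectations from the whole algebra \<open>A\<close> (the type) onto \<open>B\<close>. Complete positivity
  need not be required separately: by the bimodule property,
  \<open>\<Sum>i j. star (b i) * E (star (a i) * a j) * b j = E (star s * s)\<close> for \<open>s = (\<Sum>i. a i * b i)\<close>.\<close>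

definition conditional_expectation :: "'a::cstar_algebra set \<Rightarrow> ('a \<Rightarrow> 'a) \<Rightarrow> bool" where
  "conditional_expectation B E \<longleftrightarrow>
     (\<forall>x y. E (x + y) = E x + E y) \<and>
     (\<forall>c x. E (c *\<^sub>C x) = c *\<^sub>C E x) \<and>
     (\<forall>x. E x \<in> B) \<and> (\<forall>b\<in>B. E b = b) \<and>
     (\<forall>b\<in>B. \<forall>b'\<in>B. \<forall>x. E (b * x * b') = b * E x * b') \<and>
     (\<forall>x. le_in B 0 (E (star x * x))) \<and>
     (\<forall>x. norm (E x) \<le> norm x)"

definition cstar_ncps :: "'a::cstar_algebra set \<Rightarrow> ('a \<Rightarrow> 'a) \<Rightarrow> bool" where
  "cstar_ncps B E \<longleftrightarrow> unital_cstar_subalgebra B \<and> conditional_expectation B E"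

text \<open>Faithfulness of the GNS representation of the C*-algebra \<open>D\<close> on \<open>L\<^sup>2(D, E)\<close>. It holds whenever
  \<open>E\<close> is faithful, i.e. \<open>E (star a * a) = 0\<close> only for \<open>a = 0\<close>. Some such convention is implicit
  whenever an operator is studied through its \<open>B\<close>-valued moments: without it, a direct summand of \<open>T\<close>
  on which \<open>E\<close> does not depend can be an arbitrary element. With \<open>D\<close> generated by \<open>B\<close> and \<open>T\<close> it says
  that the moments determine the norm on \<open>D\<close>.\<close>

definition gns_faithful_on :: "'a::cstar_algebra set \<Rightarrow> ('a \<Rightarrow> 'a) \<Rightarrow> bool" where
  "gns_faithful_on D E \<longleftrightarrow>
     (\<forall>a\<in>D. (\<forall>x\<in>D. E (star (a * x) * (a * x)) = 0) \<longrightarrow> a = 0)"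

text \<open>Words in \<open>T\<close> and its adjoint: the flag \<open>\<epsilon> k\<close> is true when the \<open>k\<close>-th letter is starred.
  \<open>word_moment E T \<epsilon> b i j\<close> is the expectation of the product of \<open>T\<^sup>\<epsilon>\<^sup>k * b k\<close> over \<open>i \<le> k \<le> j\<close>,
  the product being \<open>1\<close> if \<open>j < i\<close>.\<close>

definition eps_power :: "'a::cstar_algebra \<Rightarrow> bool \<Rightarrow> 'a" where
  "eps_power T e = (if e then star T else T)"

definition word_moment ::
  "('a::cstar_algebra \<Rightarrow> 'a) \<Rightarrow> 'a \<Rightarrow> (nat \<Rightarrow> bool) \<Rightarrow> (nat \<Rightarrow> 'a) \<Rightarrow> nat \<Rightarrow> nat \<Rightarrow> 'a" where
  "word_moment E T \<epsilon> b i j = E (prod_list (map (\<lambda>k. eps_power T (\<epsilon> k) * b k) [i..<Suc j]))"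

definition cov :: "('a::cstar_algebra \<Rightarrow> 'a) \<Rightarrow> 'a \<Rightarrow> bool \<Rightarrow> 'a \<Rightarrow> 'a" where
  "cov E T e x = (if e then E (star T * x * T) else E (T * x * star T))"

text \<open>The vanishing of all cumulants of \<open>T\<close> and its adjoint other than the two covariances, expressed
  by the moment-cumulant formula; the \<open>j\<close>-th summand collects the noncrossing pairings which pair
  the first letter with the \<open>j\<close>-th.\<close>

definition B_circular :: "'a::cstar_algebra set \<Rightarrow> ('a \<Rightarrow> 'a) \<Rightarrow> 'a \<Rightarrow> bool" where
  "B_circular B E T \<longleftrightarrow> E T = 0 \<and>
     (\<forall>n\<ge>1. \<forall>\<epsilon> b. (\<forall>k\<in>{1..n}. b k \<in> B) \<longrightarrow>
        word_moment E T \<epsilon> b 1 n =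
          (\<Sum>j \<in> {j\<in>{2..n}. \<epsilon> j \<noteq> \<epsilon> 1}.
             cov E T (\<epsilon> 1) (b 1 * word_moment E T \<epsilon> b 2 (j - 1)) * b j *
             word_moment E T \<epsilon> b (j + 1) n))"

end

theory Submission
  imports Defs
begin

text \<open>Call an element upper triangular if it differs from its expectation by a limit of polynomials in
  \<open>B\<close>, \<open>T\<close>, \<open>star T\<close> whose terms contain \<open>T\<close> more often than \<open>star T\<close>. Unbalanced words in a circular
  element have expectation \<open>0\<close>, so \<open>E\<close> is multiplicative on upper triangular elements. Hence every
  such \<open>x\<close> satisfies \<open>E (x ^ n) = E x ^ n\<close>, and with \<open>e = E x ^ n\<close> the bimodule property gives
  \<open>E (star (x ^ n) * x ^ n) - star e * e = E (star (x ^ n - e) * (x ^ n - e))\<close>, which is positive. The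
  two inequalities of the theorem are the cases \<open>x = Z\<close>, with \<open>E Z = b\<close>, and \<open>x = Z\<^sup>-\<^sup>1\<close>, with
  \<open>E Z\<^sup>-\<^sup>1 = b\<^sup>-\<^sup>1\<close> (\<open>upper_triangular_power_ge\<close>).

  The inverse of \<open>Z = b * (1 - s)\<close>, \<open>s = - b\<^sup>-\<^sup>1 * T\<close>, is given by the Neumann series of \<open>s\<close>, whose terms
  have positive degree in \<open>T\<close>. Its convergence is the real content, since \<open>T\<close> and \<open>b\<close> need not
  commute: it follows from \<open>norm ((c * T) ^ n) \<le> (2 * norm c) ^ n * norm (T ^ n)\<close> for \<open>c \<in> B\<close>
  (\<open>norm_coef_mult_power_le\<close>), because quasinilpotency makes \<open>norm (T ^ n)\<close> decay faster than any
  geometric sequence (\<open>quasinilpotent_summable\<close>).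

  As every \<open>c \<in> B\<close> is \<open>norm c / 2\<close> times a sum of four unitaries of \<open>B\<close>, it suffices to see that
  \<open>norm (c\<^sub>1 * T * \<dots> * c\<^sub>n * T) \<le> norm (T ^ n)\<close> for unitary coefficients
  (\<open>norm_coef_power_unitary_le\<close>). Assign heights to the positions in a word so that \<open>T\<close> passes from
  height \<open>h\<close> to \<open>h + 1\<close> and \<open>star T\<close> back, reading from the right. Replacing each \<open>T\<close> by
  \<open>d h * T\<close> and each \<open>star T\<close> by \<open>star T * star (d h)\<close>, with \<open>d h\<close> unitary in \<open>B\<close>, preserves all moments:
  the moment formula pairs letters lying between the same heights, and in the commutative algebra
  \<open>B\<close> the two unitaries cancel (\<open>E_word_twist\<close>). On elements of a fixed degree in \<open>L\<^sup>2(E)\<close> such a twist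
  turns left multiplication by \<open>c\<^sub>1 * T * \<dots> * c\<^sub>n * T\<close> into that by \<open>T ^ n\<close>, and elements of different
  degrees are orthogonal. This bounds the operator in \<open>L\<^sup>2(E)\<close>; faithfulness of this representation
  turns the bound into one for the norm (\<open>norm_le_of_L2_operator_bound\<close>).\<close>

section \<open>Elementary facts about C*-algebras\<close>

instance cstar_algebra \<subseteq> banach ..

lemma scaleC_one [simp]: "1 *\<^sub>C (x::'a::cstar_algebra) = x"
  using scaleR_eq_scaleC[of 1 x] by simp

lemma scaleC_minus_left: "(- c) *\<^sub>C (x::'a::cstar_algebra) = - (c *\<^sub>C x)"
  using scaleR_eq_scaleC[of "-1" "c *\<^sub>C x"] by (simp add: scaleC_scaleC)

lemma scaleC_minus_right: "c *\<^sub>C (- x) = - (c *\<^sub>C (x::'a::cstar_algebra))"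
  using scaleC_scaleC[of c "-1" x] scaleR_eq_scaleC[of "-1" x] by (simp add: scaleC_minus_left)

lemma scaleC_diff_right: "c *\<^sub>C (x - y) = c *\<^sub>C x - c *\<^sub>C (y::'a::cstar_algebra)"
  using scaleC_add_right[of c x "- y"] by (simp add: scaleC_minus_right)

lemma scaleC_zero_left [simp]: "0 *\<^sub>C (x::'a::cstar_algebra) = 0"
  using scaleR_eq_scaleC[of 0 x] by simp

lemma star_zero [simp]: "star (0::'a::cstar_algebra) = 0"
  using star_add[of 0 "0::'a"] by simp

lemma star_minus: "star (- x) = - star (x::'a::cstar_algebra)"
  using star_add[of x "- x"] by (simp add: eq_neg_iff_add_eq_0 add.commute)

lemma star_diff: "star (x - y) = star x - star (y::'a::cstar_algebra)"
  using star_add[of x "- y"] by (simp add: star_minus)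

lemma star_one [simp]: "star (1::'a::cstar_algebra) = 1"
proof -
  have "star (star (1::'a) * 1) = star (star (1::'a))"
    by simp
  then show ?thesis
    using star_mult[of "star (1::'a)" 1] by (simp add: star_star)
qed

lemma star_scaleR: "star (r *\<^sub>R x) = r *\<^sub>R star (x::'a::cstar_algebra)"
  by (simp add: scaleR_eq_scaleC star_scaleC)

lemma star_power: "star (x ^ n) = star (x::'a::cstar_algebra) ^ n"
  by (induction n) (simp_all add: star_mult power_commutes)

lemma norm_star: "norm (star x) = norm (x::'a::cstar_algebra)"
proof -
  have le: "norm y \<le> norm (star y)" for y :: 'a
  proof (cases "y = 0")
    case False
    have "norm y * norm y \<le> norm (star y) * norm y"
      using norm_mult_ineq[of "star y" y] cstar_identity[of y] by (simp add: power2_eq_square)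
    then show ?thesis using False by simp
  qed simp
  show ?thesis using le[of x] le[of "star x"] by (simp add: star_star)
qed

lemma bounded_linear_star: "bounded_linear (star :: 'a::cstar_algebra \<Rightarrow> 'a)"
  by (rule bounded_linear_intro[where K=1]) (simp_all add: star_add star_scaleR norm_star)

lemma bounded_linear_scaleC: "bounded_linear ((*\<^sub>C) c :: 'a::cstar_algebra \<Rightarrow> 'a)"
proof (rule bounded_linear_intro[where K = "cmod c"])
  show "c *\<^sub>C r *\<^sub>R x = r *\<^sub>R (c *\<^sub>C (x::'a))" for r x
    by (simp add: scaleR_eq_scaleC scaleC_scaleC mult.commute)
qed (simp_all add: scaleC_add_right norm_scaleC)

lemma norm_square_of_selfadjoint: "star x = x \<Longrightarrow> norm (x * x) = (norm (x::'a::cstar_algebra))\<^sup>2"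
  using cstar_identity[of x] by simp

subsection \<open>Unital C*-subalgebras\<close>

lemma cstar_subalgebraD:
  assumes "unital_cstar_subalgebra (S::'a::cstar_algebra set)"
  shows "closed S" "1 \<in> S" "0 \<in> S"
    "\<And>x y. x \<in> S \<Longrightarrow> y \<in> S \<Longrightarrow> x + y \<in> S"
    "\<And>x y. x \<in> S \<Longrightarrow> y \<in> S \<Longrightarrow> x * y \<in> S"
    "\<And>x. x \<in> S \<Longrightarrow> star x \<in> S"
    "\<And>c x. x \<in> S \<Longrightarrow> c *\<^sub>C x \<in> S"
    "\<And>r x. x \<in> S \<Longrightarrow> r *\<^sub>R x \<in> S"
    "\<And>x. x \<in> S \<Longrightarrow> - x \<in> S"
    "\<And>x y. x \<in> S \<Longrightarrow> y \<in> S \<Longrightarrow> x - y \<in> S"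
    "\<And>x n. x \<in> S \<Longrightarrow> x ^ n \<in> S"
proof -
  note S = assms[unfolded unital_cstar_subalgebra_def]
  show "closed S" and one: "1 \<in> S" using S by auto
  show add: "\<And>x y. x \<in> S \<Longrightarrow> y \<in> S \<Longrightarrow> x + y \<in> S" using S by auto
  show mult: "\<And>x y. x \<in> S \<Longrightarrow> y \<in> S \<Longrightarrow> x * y \<in> S" using S by auto
  show "\<And>x. x \<in> S \<Longrightarrow> star x \<in> S" using S by auto
  show sc: "\<And>c x. x \<in> S \<Longrightarrow> c *\<^sub>C x \<in> S" using S by auto
  show sr: "\<And>r x. x \<in> S \<Longrightarrow> r *\<^sub>R x \<in> S" using sc by (simp add: scaleR_eq_scaleC)
  show "0 \<in> S" using sc[OF one, of 0] by simp
  show neg: "\<And>x. x \<in> S \<Longrightarrow> - x \<in> S" using sr[of _ "-1"] by simp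
  show "\<And>x y. x \<in> S \<Longrightarrow> y \<in> S \<Longrightarrow> x - y \<in> S" using add neg by (metis diff_conv_add_uminus)
  show "x \<in> S \<Longrightarrow> x ^ n \<in> S" for x n by (induction n) (auto intro: mult one)
qed

lemma cstar_subalgebra_UNIV: "unital_cstar_subalgebra (UNIV :: 'a::cstar_algebra set)"
  by (simp add: unital_cstar_subalgebra_def)

lemma cstar_generated_subalgebra: "unital_cstar_subalgebra (cstar_generated X)"
  unfolding unital_cstar_subalgebra_def cstar_generated_def
  by (auto simp: cstar_subalgebraD intro!: closed_Inter)

lemma cstar_generated_superset: "X \<subseteq> cstar_generated X"
  by (auto simp: cstar_generated_def)

lemma cstar_generated_minimal: "unital_cstar_subalgebra S \<Longrightarrow> X \<subseteq> S \<Longrightarrow> cstar_generated X \<subseteq> S"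
  by (auto simp: cstar_generated_def)

section \<open>Square roots\<close>

text \<open>These are the Taylor coefficients of \<open>\<lambda>t. sqrt (1 - t)\<close> at \<open>0\<close>.\<close>

definition sqrt_coeff :: "nat \<Rightarrow> real" where
  "sqrt_coeff k = pochhammer (- (1/2)) k / fact k"

lemma sqrt_coeff_0 [simp]: "sqrt_coeff 0 = 1"
  by (simp add: sqrt_coeff_def)

lemma sqrt_coeff_gbinomial: "sqrt_coeff k = (-1) ^ k * ((1/2) gchoose k)"
  by (simp add: sqrt_coeff_def gbinomial_pochhammer flip: power_mult_distrib)

lemma sqrt_coeff_nonpos: "k > 0 \<Longrightarrow> sqrt_coeff k \<le> 0"
proof (cases k)
  case (Suc m)
  have "pochhammer (1/2::real) m \<ge> 0" by (rule pochhammer_nonneg) simp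
  then show ?thesis using Suc by (simp add: sqrt_coeff_def pochhammer_rec divide_nonpos_pos)
qed simp

text \<open>The partial sums of all coefficients are \<open>pochhammer (1/2) n / fact n \<ge> 0\<close>, and the coefficient
  with index \<open>0\<close> is \<open>1\<close>. The series therefore still converges absolutely on the boundary of the
  unit ball.\<close>

lemma sqrt_coeff_partial_sum: "(\<Sum>k<n. - sqrt_coeff (Suc k)) \<le> 1"
proof -
  have "(\<Sum>k\<le>n. sqrt_coeff k) = (-1) ^ n * ((1/2) - 1 gchoose n)"
    using gbinomial_sum_lower_neg[of "1/2::real" n]
    by (simp add: sqrt_coeff_gbinomial mult.commute)
  also have "\<dots> = pochhammer (1/2) n / fact n"
    by (simp add: gbinomial_pochhammer flip: power_mult_distrib)
  also have "\<dots> \<ge> 0"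
    by (simp add: pochhammer_nonneg)
  finally have "0 \<le> (\<Sum>k\<le>n. sqrt_coeff k)" .
  also have "(\<Sum>k\<le>n. sqrt_coeff k) = 1 + (\<Sum>k<n. sqrt_coeff (Suc k))"
    by (simp add: sum.atMost_shift)
  finally show ?thesis by (simp add: sum_negf)
qed

lemma sqrt_coeff_summable: "summable (\<lambda>k. \<bar>sqrt_coeff k\<bar>)"
  and sqrt_coeff_suminf: "(\<Sum>k. \<bar>sqrt_coeff (Suc k)\<bar>) \<le> 1"
proof -
  have eq: "\<bar>sqrt_coeff (Suc k)\<bar> = - sqrt_coeff (Suc k)" for k
    using sqrt_coeff_nonpos[of "Suc k"] by simp
  have s: "summable (\<lambda>k. \<bar>sqrt_coeff (Suc k)\<bar>)"
    by (rule bounded_imp_summable[where B=1])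
      (simp_all only: eq lessThan_Suc_atMost[symmetric] sqrt_coeff_partial_sum,
       simp add: sqrt_coeff_nonpos)
  then show "summable (\<lambda>k. \<bar>sqrt_coeff k\<bar>)" using summable_Suc_iff[of "\<lambda>k. \<bar>sqrt_coeff k\<bar>"] by simp
  show "(\<Sum>k. \<bar>sqrt_coeff (Suc k)\<bar>) \<le> 1"
    by (rule suminf_le_const[OF s]) (use sqrt_coeff_partial_sum in \<open>auto simp: eq\<close>)
qed

text \<open>The square of the series is \<open>1 - t\<close>, by the Vandermonde identity for \<open>1/2 + 1/2 = 1\<close>.\<close>

lemma sqrt_coeff_convolution:
  "(\<Sum>i\<le>n. sqrt_coeff i * sqrt_coeff (n - i)) = (if n = 0 then 1 else if n = 1 then -1 else 0)"
proof -
  have "(\<Sum>i\<le>n. sqrt_coeff i * sqrt_coeff (n - i)) =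
      (\<Sum>i\<in>{0..n}. (-1) ^ n * (((1/2) gchoose i) * ((1/2) gchoose (n - i))))"
    unfolding atMost_atLeast0
    by (rule sum.cong) (auto simp: sqrt_coeff_gbinomial simp flip: power_add)
  also have "\<dots> = (-1) ^ n * ((1/2 + 1/2 :: real) gchoose n)"
    by (simp only: flip: sum_distrib_left gbinomial_Vandermonde)
  also have "(1/2 + 1/2 :: real) = of_nat 1" by simp
  also have "(-1) ^ n * (of_nat 1 gchoose n) = (-1) ^ n * real (1 choose n)"
    by (simp only: binomial_gbinomial)
  also have "\<dots> = (if n = 0 then 1 else if n = 1 then -1 else 0)"
    by (cases n rule: nat.exhaust) (auto simp: not_less_eq_eq)
  finally show ?thesis .
qed

text \<open>The root is the power series of \<open>\<lambda>t. sqrt (1 - t)\<close> at \<open>t = 1 - x\<close>. As a limit of real polynomials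
  in \<open>x\<close> it is selfadjoint, stays in every closed subalgebra and commutes with whatever commutes
  with \<open>x\<close>.\<close>

lemma cstar_sqrt_exists:
  fixes x :: "'a::cstar_algebra"
  assumes S: "unital_cstar_subalgebra S" and x: "x \<in> S" "star x = x" and nx: "norm (1 - x) \<le> 1"
  obtains r where "r \<in> S" "star r = r" "r * r = x" "norm (1 - r) \<le> 1"
    "\<And>y. y * x = x * y \<Longrightarrow> y * r = r * y"
proof -
  define t where "t = 1 - x"
  define f where "f k = sqrt_coeff k *\<^sub>R t ^ k" for k
  define r where "r = (\<Sum>k. f k)"
  note Sd = cstar_subalgebraD[OF S]
  have tS: "t \<in> S" and tsa: "star t = t" using x Sd by (auto simp: t_def star_diff)
  have nt: "norm (t ^ k) \<le> 1" for k
  proof -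
    have "norm (t ^ k) \<le> norm t ^ k" by (rule norm_power_ineq)
    also have "\<dots> \<le> 1" using nx by (simp add: t_def power_le_one)
    finally show ?thesis .
  qed
  have nf: "norm (f k) \<le> \<bar>sqrt_coeff k\<bar>" for k
    using mult_left_mono[OF nt[of k], of "\<bar>sqrt_coeff k\<bar>"] by (simp add: f_def)
  have sf: "summable (\<lambda>k. norm (f k))"
    by (rule summable_comparison_test'[OF sqrt_coeff_summable, of 0]) (use nf in auto)
  have fsum: "f sums r" unfolding r_def by (rule summable_sums[OF summable_norm_cancel[OF sf]])
  then have lim: "(\<lambda>n. \<Sum>k<n. f k) \<longlonglongrightarrow> r" by (simp add: sums_def)
  have "(\<Sum>k<n. f k) \<in> S" for n
    by (induction n) (auto simp: f_def intro!: Sd tS)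
  then have rS: "r \<in> S" using lim Sd(1) by (rule_tac closed_sequentially) auto
  have "(\<lambda>k. star (f k)) sums star r" by (rule bounded_linear.sums[OF bounded_linear_star fsum])
  then have rsa: "star r = r"
    using fsum by (simp add: f_def[abs_def] star_scaleR star_power tsa sums_iff)
  have "(\<lambda>k. \<Sum>i\<le>k. f i * f (k - i)) sums (r * r)"
    unfolding r_def by (rule Cauchy_product_sums[OF sf sf])
  moreover have "(\<Sum>i\<le>k. f i * f (k - i)) =
      (if k = 0 then 1 else if k = 1 then -1 else 0) *\<^sub>R t ^ k" for k
  proof -
    have "(\<Sum>i\<le>k. f i * f (k - i)) = (\<Sum>i\<le>k. (sqrt_coeff i * sqrt_coeff (k - i)) *\<^sub>R t ^ k)"
      by (rule sum.cong) (auto simp: f_def simp flip: power_add)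
    also have "\<dots> = (\<Sum>i\<le>k. sqrt_coeff i * sqrt_coeff (k - i)) *\<^sub>R t ^ k"
      by (simp only: scaleR_sum_left)
    finally show ?thesis by (simp only: sqrt_coeff_convolution)
  qed
  ultimately have "(\<lambda>k. (if k = 0 then 1 else if k = 1 then -1 else 0) *\<^sub>R t ^ k) sums (r * r)"
    by (simp only:)
  moreover have "(\<lambda>k. (if k = 0 then 1 else if k = 1 then -1 else 0) *\<^sub>R t ^ k) sums
      (\<Sum>k\<in>{0,1}. (if k = 0 then 1 else if k = 1 then -1 else (0::real)) *\<^sub>R t ^ k)"
    by (rule sums_finite) auto
  ultimately have "r * r = 1 - t" using sums_unique2 by fastforce
  then have rr: "r * r = x" by (simp add: t_def)
  have "(\<lambda>k. f (Suc k)) sums (r - f 0)" using fsum by (simp add: sums_Suc_iff)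
  then have "norm (r - 1) = norm (\<Sum>k. f (Suc k))" by (simp add: f_def sums_iff)
  also have "\<dots> \<le> (\<Sum>k. \<bar>sqrt_coeff (Suc k)\<bar>)"
    by (rule norm_suminf_le) (use nf summable_ignore_initial_segment[OF sqrt_coeff_summable, of 1] in auto)
  also have "\<dots> \<le> 1" by (rule sqrt_coeff_suminf)
  finally have n1: "norm (1 - r) \<le> 1" by (simp add: norm_minus_commute)
  have comm: "y * r = r * y" if "y * x = x * y" for y
  proof -
    have "y * t = t * y" using that by (simp add: t_def algebra_simps)
    then have "y * t ^ k = t ^ k * y" for k
      by (rule power_commuting_commutes[symmetric, OF sym])
    then have "y * f k = f k * y" for k by (simp add: f_def)
    moreover have "(\<lambda>k. y * f k) sums (y * r)" "(\<lambda>k. f k * y) sums (r * y)"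
      using fsum by (auto intro: sums_mult sums_mult2)
    ultimately show ?thesis using sums_unique2 by auto
  qed
  show thesis using that rS rsa rr n1 comm by blast
qed

section \<open>Positive elements\<close>

text \<open>A selfadjoint \<open>x\<close> satisfies this norm inequality iff its spectrum is nonnegative. This
  description is visibly a closed condition and feeds directly into the series for the
  square root.\<close>

definition positive :: "'a::cstar_algebra \<Rightarrow> bool" where
  "positive x \<longleftrightarrow> star x = x \<and> norm (norm x *\<^sub>R 1 - x) \<le> norm x"

lemma star_of_complex_combination:
  fixes x y :: "'a::cstar_algebra"
  assumes "star x = x" "star y = y"
  shows "star (x + \<i> *\<^sub>C y) = x + (-\<i>) *\<^sub>C y"
  by (simp add: star_add star_scaleC assms)

lemma i_scaleC_cancel: "\<i> *\<^sub>C (x::'a::cstar_algebra) + (-\<i>) *\<^sub>C x = 0"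
  by (simp flip: scaleC_add_left)

lemma abs_square_of_commuting_parts:
  fixes x y :: "'a::cstar_algebra"
  assumes sa: "star x = x" "star y = y" and xy: "x * y = y * x"
  shows "star (x + \<i> *\<^sub>C y) * (x + \<i> *\<^sub>C y) = x * x + y * y"
proof -
  have "star (x + \<i> *\<^sub>C y) * (x + \<i> *\<^sub>C y) = x * x + y * y + (\<i> *\<^sub>C (x * y) + (-\<i>) *\<^sub>C (y * x))"
    unfolding star_of_complex_combination[OF sa]
    by (simp add: distrib_left distrib_right scaleC_mult_left scaleC_mult_right scaleC_scaleC scaleC_add_right add_ac)
  then show ?thesis unfolding xy i_scaleC_cancel by simp
qed

lemma norm_real_part_le:
  fixes x y :: "'a::cstar_algebra"
  assumes sa: "star x = x" "star y = y"
  shows "norm x \<le> norm (x + \<i> *\<^sub>C y)"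
proof -
  let ?u = "x + \<i> *\<^sub>C y"
  have "?u + star ?u = 2 *\<^sub>R x + (\<i> *\<^sub>C y + (-\<i>) *\<^sub>C y)"
    unfolding star_of_complex_combination[OF sa] scaleR_2 by (simp only: add_ac)
  then have "2 * norm x = norm (?u + star ?u)" unfolding i_scaleC_cancel by simp
  also have "\<dots> \<le> 2 * norm ?u" using norm_triangle_ineq[of ?u "star ?u"] by (simp add: norm_star)
  finally show ?thesis by simp
qed

text \<open>\<open>x\<close> is the real part of \<open>x + \<i> *\<^sub>C y\<close>, and the sum of the squares is the absolute square of
  this element.\<close>

lemma norm_le_of_sum_of_commuting_squares:
  fixes x y :: "'a::cstar_algebra"
  assumes sa: "star x = x" "star y = y" and xy: "x * y = y * x"
  shows "norm (x * x) \<le> norm (x * x + y * y)"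
proof -
  have "(norm x)\<^sup>2 \<le> (norm (x + \<i> *\<^sub>C y))\<^sup>2"
    by (rule power_mono[OF norm_real_part_le[OF sa]]) simp
  also have "\<dots> = norm (x * x + y * y)"
    using cstar_identity[of "x + \<i> *\<^sub>C y"] abs_square_of_commuting_parts[OF assms] by simp
  finally show ?thesis using norm_square_of_selfadjoint[OF sa(1)] by simp
qed

text \<open>The series gives a selfadjoint root \<open>s\<close> of \<open>1 - y * y\<close>, because \<open>y * y\<close> has norm at most \<open>1\<close>. Then
  \<open>s * s + y * y = 1\<close> is a sum of commuting squares, which bounds the norm of \<open>s * s\<close>.\<close>

lemma norm_one_minus_square_le:
  fixes y :: "'a::cstar_algebra"
  assumes y: "star y = y" "norm y \<le> 1"
  shows "norm (1 - y * y) \<le> 1"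
proof -
  have nm: "norm (1 - (1 - y * y)) \<le> 1"
    using norm_square_of_selfadjoint[OF y(1)] y(2) by (simp add: power_le_one)
  have sa: "star (1 - y * y) = 1 - y * y"
    by (simp add: star_diff star_mult y)
  obtain s where s: "star s = s" "s * s = 1 - y * y"
    "\<And>z. z * (1 - y * y) = (1 - y * y) * z \<Longrightarrow> z * s = s * z"
    by (rule cstar_sqrt_exists[OF cstar_subalgebra_UNIV UNIV_I sa nm]) blast
  have "s * y = y * s" by (rule s(3)[symmetric]) (simp add: left_diff_distrib right_diff_distrib mult.assoc)
  then have "norm (s * s) \<le> norm (s * s + y * y)"
    by (rule norm_le_of_sum_of_commuting_squares[OF s(1) y(1)])
  then show ?thesis using s(2) by simp
qed

lemma positive_zero [simp]: "positive 0"
  by (simp add: positive_def)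

lemma positive_square:
  fixes y :: "'a::cstar_algebra"
  assumes "star y = y"
  shows "positive (y * y)"
proof (cases "y = 0")
  case False
  define z where "z = (1 / norm y) *\<^sub>R y"
  have z: "star z = z" "norm z \<le> 1" using assms False by (simp_all add: z_def star_scaleR)
  have n: "norm (y * y) = (norm y)\<^sup>2" by (rule norm_square_of_selfadjoint[OF assms])
  have "(norm y)\<^sup>2 *\<^sub>R 1 - y * y = (norm y)\<^sup>2 *\<^sub>R (1 - z * z)"
    using False by (simp add: z_def algebra_simps power2_eq_square)
  then have "norm ((norm y)\<^sup>2 *\<^sub>R 1 - y * y) = (norm y)\<^sup>2 * norm (1 - z * z)" by simp
  also have "\<dots> \<le> (norm y)\<^sup>2 * 1"
    by (rule mult_left_mono[OF norm_one_minus_square_le[OF z]]) simp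
  finally show ?thesis by (simp add: positive_def n star_mult assms)
qed simp

lemma positive_if_norm_diff_le:
  fixes x :: "'a::cstar_algebra"
  assumes S: "unital_cstar_subalgebra S" and x: "x \<in> S" "star x = x" and le: "norm (R *\<^sub>R 1 - x) \<le> R"
  obtains r where "r \<in> S" "star r = r" "r * r = x" "norm (sqrt R *\<^sub>R 1 - r) \<le> sqrt R"
    "\<And>y. y * x = x * y \<Longrightarrow> y * r = r * y"
proof (cases "R = 0")
  case True
  then have "x = 0" using le by simp
  then show thesis using that[of 0] cstar_subalgebraD(3)[OF S] True by simp
next
  case False
  moreover have "R \<ge> 0" using le norm_ge_zero order_trans by blast
  ultimately have R: "R > 0" by simp
  define z where "z = (1 / R) *\<^sub>R x"
  have "R *\<^sub>R 1 - x = R *\<^sub>R (1 - z)" using R by (simp add: z_def algebra_simps)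
  then have "R * norm (1 - z) \<le> R" using le R by simp
  then have nz: "norm (1 - z) \<le> 1" using R by simp
  have z: "z \<in> S" "star z = z" using x cstar_subalgebraD[OF S] by (auto simp: z_def star_scaleR)
  obtain s where s: "s \<in> S" "star s = s" "s * s = z" "norm (1 - s) \<le> 1" "\<And>y. y * z = z * y \<Longrightarrow> y * s = s * y"
    by (rule cstar_sqrt_exists[OF S z nz]) blast
  define r where "r = sqrt R *\<^sub>R s"
  have "r \<in> S" "star r = r" using s(1-3) cstar_subalgebraD[OF S] by (auto simp: r_def star_scaleR)
  moreover have "r * r = x" using R s(3) by (simp add: r_def z_def)
  moreover have "norm (sqrt R *\<^sub>R 1 - r) \<le> sqrt R"
    using R s(4) by (simp add: r_def flip: scaleR_diff_right)
  moreover have "y * r = r * y" if "y * x = x * y" for y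
    using s(5)[of y] that by (simp add: r_def z_def)
  ultimately show thesis by (rule that)
qed

text \<open>In the definition of positivity any radius may take the place of \<open>norm x\<close>, which makes
  positivity additive.\<close>

lemma positive_of_norm_diff_le:
  fixes x :: "'a::cstar_algebra"
  assumes "star x = x" "norm (R *\<^sub>R 1 - x) \<le> R"
  shows "positive x"
  by (rule positive_if_norm_diff_le[OF cstar_subalgebra_UNIV UNIV_I assms]) (metis positive_square)

lemma positive_sqrt:
  fixes x :: "'a::cstar_algebra"
  assumes S: "unital_cstar_subalgebra S" and x: "x \<in> S" "positive x"
  obtains r where "r \<in> S" "positive r" "star r = r" "r * r = x" "\<And>y. y * x = x * y \<Longrightarrow> y * r = r * y"
proof -
  have "star x = x" "norm (norm x *\<^sub>R 1 - x) \<le> norm x" using x(2) by (auto simp: positive_def)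
  then obtain r where r: "r \<in> S" "star r = r" "r * r = x" "norm (sqrt (norm x) *\<^sub>R 1 - r) \<le> sqrt (norm x)"
    "\<And>y. y * x = x * y \<Longrightarrow> y * r = r * y"
    by (rule positive_if_norm_diff_le[OF S x(1)]) blast
  have "positive r" by (rule positive_of_norm_diff_le[OF r(2,4)])
  then show thesis using r(1,2,3,5) by (intro that)
qed

lemma positive_add:
  fixes x y :: "'a::cstar_algebra"
  assumes "positive x" "positive y"
  shows "positive (x + y)"
proof (rule positive_of_norm_diff_le[where R = "norm x + norm y"])
  show "star (x + y) = x + y" using assms by (simp add: positive_def star_add)
  have "norm ((norm x + norm y) *\<^sub>R 1 - (x + y)) = norm ((norm x *\<^sub>R 1 - x) + (norm y *\<^sub>R 1 - y))"
    by (simp add: algebra_simps)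
  also have "\<dots> \<le> norm x + norm y"
    using assms by (intro norm_triangle_mono) (auto simp: positive_def)
  finally show "norm ((norm x + norm y) *\<^sub>R 1 - (x + y)) \<le> norm x + norm y" .
qed

lemma positive_scaleR:
  fixes x :: "'a::cstar_algebra"
  assumes "positive x" "r \<ge> 0"
  shows "positive (r *\<^sub>R x)"
proof -
  have "norm ((r * norm x) *\<^sub>R 1 - r *\<^sub>R x) = norm (r *\<^sub>R (norm x *\<^sub>R 1 - x))"
    by (simp add: algebra_simps)
  also have "\<dots> \<le> r * norm x" using assms by (simp add: positive_def mult_left_mono)
  finally show ?thesis using assms by (simp add: positive_def star_scaleR)
qed

lemma positive_sum: "(\<And>i. i \<in> I \<Longrightarrow> positive (f i)) \<Longrightarrow> positive (sum f I :: 'a::cstar_algebra)"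
  by (induction I rule: infinite_finite_induct) (auto intro: positive_add)

lemma closed_positive: "closed {x::'a::cstar_algebra. positive x}"
  unfolding positive_def
  by (intro closed_Collect_conj closed_Collect_eq closed_Collect_le continuous_intros
      bounded_linear.continuous_on[OF bounded_linear_star])

text \<open>Roots of commuting positive elements commute, so \<open>x + y\<close> is a sum of commuting squares.\<close>

lemma norm_le_norm_add_of_positive:
  fixes x y :: "'a::cstar_algebra"
  assumes "positive x" "positive y" "x * y = y * x"
  shows "norm x \<le> norm (x + y)"
proof -
  obtain r where r: "star r = r" "r * r = x" "\<And>z. z * x = x * z \<Longrightarrow> z * r = r * z"
    by (rule positive_sqrt[OF cstar_subalgebra_UNIV UNIV_I assms(1)]) blast
  obtain s where s: "star s = s" "s * s = y" "\<And>z. z * y = y * z \<Longrightarrow> z * s = s * z"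
    by (rule positive_sqrt[OF cstar_subalgebra_UNIV UNIV_I assms(2)]) blast
  have "y * r = r * y" using r(3)[of y] assms(3) by simp
  then have "r * s = s * r" using s(3)[of r] by simp
  then show ?thesis using norm_le_of_sum_of_commuting_squares[OF r(1) s(1)] r(2) s(2) by simp
qed

lemma positive_add_eq_0:
  fixes x y :: "'a::cstar_algebra"
  assumes "positive x" "positive y" "x + y = 0"
  shows "x = 0"
proof -
  have "y = - x" using assms(3) by (simp add: eq_neg_iff_add_eq_0 add.commute)
  then have "norm x \<le> norm (x + y)" using assms by (intro norm_le_norm_add_of_positive) auto
  then show ?thesis using assms by simp
qed

lemma real_imaginary_parts:
  fixes c :: "'a::cstar_algebra"
  obtains x y where "star x = x" "star y = y" "c = x + \<i> *\<^sub>C y"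
    "x = (1/2) *\<^sub>R (c + star c)" "y = (1/2) *\<^sub>R (- \<i> *\<^sub>C (c - star c))"
proof -
  define u where "u = (1/2) *\<^sub>R (c + star c)"
  define v where "v = (1/2) *\<^sub>R (- \<i> *\<^sub>C (c - star c))"
  have u: "star u = u" by (simp add: u_def star_scaleR star_add star_star add.commute)
  have v: "star v = v"
    by (simp add: v_def star_scaleR star_scaleC star_minus star_diff star_star
        scaleC_minus_left scaleC_diff_right)
  have "\<i> *\<^sub>C v = (1/2) *\<^sub>R (c - star c)"
    by (simp add: v_def scaleR_eq_scaleC scaleC_scaleC)
  then have "u + \<i> *\<^sub>C v = (1/2) *\<^sub>R ((c + star c) + (c - star c))"
    by (simp only: u_def scaleR_add_right)
  also have "(c + star c) + (c - star c) = 2 *\<^sub>R c" by (simp add: scaleR_2)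
  finally have "c = u + \<i> *\<^sub>C v" by simp
  then show thesis using that[OF u v] by (simp only: u_def v_def)
qed

lemma positive_star_mult_of_normal:
  fixes c :: "'a::cstar_algebra"
  assumes "star c * c = c * star c"
  shows "positive (star c * c)"
proof -
  obtain x y where xy: "star x = x" "star y = y" "c = x + \<i> *\<^sub>C y"
    "x = (1/2) *\<^sub>R (c + star c)" "y = (1/2) *\<^sub>R (- \<i> *\<^sub>C (c - star c))"
    by (rule real_imaginary_parts)
  have c: "x * y = y * x"
  proof -
    have "(c + star c) * (c - star c) = (c - star c) * (c + star c)"
      by (simp add: distrib_left distrib_right left_diff_distrib right_diff_distrib assms)
    then show ?thesis unfolding xy(4,5) scaleR_eq_scaleC
      by (simp add: scaleC_mult_left scaleC_mult_right scaleC_scaleC)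
  qed
  show ?thesis
    unfolding xy(3) abs_square_of_commuting_parts[OF xy(1,2) c] using xy(1,2) by (simp add: positive_add positive_square)
qed

section \<open>Inverses and closures in normed algebras\<close>

lemma neumann_series_inverse:
  fixes s :: "'a::{real_normed_algebra_1,banach}"
  assumes "summable (\<lambda>n. norm (s ^ n))"
  shows "(1 - s) * (\<Sum>n. s ^ n) = 1" "(\<Sum>n. s ^ n) * (1 - s) = 1"
proof -
  have s: "summable (\<lambda>n. s ^ n)" by (rule summable_norm_cancel[OF assms])
  have head: "(\<Sum>n. s ^ n) = 1 + (\<Sum>n. s ^ Suc n)"
    using suminf_split_head[OF s] by simp
  have "(\<Sum>n. s ^ Suc n) = s * (\<Sum>n. s ^ n)" using suminf_mult[OF s, of s] by simp
  with head show "(1 - s) * (\<Sum>n. s ^ n) = 1" by (simp add: left_diff_distrib)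
  have "(\<Sum>n. s ^ Suc n) = (\<Sum>n. s ^ n) * s"
    using suminf_mult2[OF s, of s] by (simp add: power_commutes)
  with head show "(\<Sum>n. s ^ n) * (1 - s) = 1" by (simp add: right_diff_distrib)
qed

lemma ring_inv_eqI:
  assumes "x * y = 1" "y * x = 1"
  shows "ring_inv x = (y :: 'a::ring_1)"
  unfolding ring_inv_def
proof (rule the_equality)
  fix z assume "x * z = 1 \<and> z * x = 1"
  then have "z = z * (x * y)" "z * x * y = y" using assms by simp_all
  then show "z = y" by (simp add: mult.assoc)
qed (use assms in blast)

lemma closure_mult_mem:
  fixes x y :: "'a::real_normed_algebra"
  assumes "x \<in> closure S" "y \<in> closure U" and "\<And>s u. s \<in> S \<Longrightarrow> u \<in> U \<Longrightarrow> s * u \<in> V"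
  shows "x * y \<in> closure V"
proof -
  obtain s u where "\<And>n. s n \<in> S" "s \<longlonglongrightarrow> x" "\<And>n. u n \<in> U" "u \<longlonglongrightarrow> y"
    using assms(1,2) by (auto simp: closure_sequential)
  then have "(\<lambda>n. s n * u n) \<longlonglongrightarrow> x * y" "\<And>n. s n * u n \<in> V"
    using assms(3) by (auto intro: tendsto_mult)
  then show ?thesis unfolding closure_sequential by (intro exI[of _ "\<lambda>n. s n * u n"]) auto
qed

lemma closure_add_mem:
  fixes x y :: "'a::real_normed_vector"
  assumes "x \<in> closure S" "y \<in> closure S" and "\<And>s u. s \<in> S \<Longrightarrow> u \<in> S \<Longrightarrow> s + u \<in> S"
  shows "x + y \<in> closure S"
proof -
  obtain s u where "\<And>n. s n \<in> S" "s \<longlonglongrightarrow> x" "\<And>n. u n \<in> S" "u \<longlonglongrightarrow> y"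
    using assms(1,2) by (auto simp: closure_sequential)
  then have "(\<lambda>n. s n + u n) \<longlonglongrightarrow> x + y" "\<And>n. s n + u n \<in> S"
    using assms(3) by (auto intro: tendsto_add)
  then show ?thesis unfolding closure_sequential by (intro exI[of _ "\<lambda>n. s n + u n"]) auto
qed

lemma closure_bounded_linear_mem:
  assumes "bounded_linear f" "x \<in> closure S" "\<And>s. s \<in> S \<Longrightarrow> f s \<in> V"
  shows "f x \<in> closure V"
proof -
  obtain s where "\<And>n. s n \<in> S" "s \<longlonglongrightarrow> x"
    using assms(2) by (auto simp: closure_sequential)
  then have "(\<lambda>n. f (s n)) \<longlonglongrightarrow> f x" "\<And>n. f (s n) \<in> V"
    using assms(3) by (auto intro: bounded_linear.tendsto[OF assms(1)])
  then show ?thesis unfolding closure_sequential by (intro exI[of _ "\<lambda>n. f (s n)"]) auto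
qed

section \<open>Quasinilpotent elements\<close>

lemma power_scaleC: "(c *\<^sub>C x) ^ n = c ^ n *\<^sub>C (x::'a::cstar_algebra) ^ n"
  by (induction n) (simp_all add: scaleC_mult_left scaleC_mult_right scaleC_scaleC power_commutes)

lemma scaleC_sum_left: "(\<Sum>k\<in>A. f k) *\<^sub>C (x::'a::cstar_algebra) = (\<Sum>k\<in>A. f k *\<^sub>C x)"
  by (induction A rule: infinite_finite_induct) (simp_all add: scaleC_add_left)

lemma one_minus_mult_geometric_sum:
  "(1 - x) * (\<Sum>j<n. x ^ j) = 1 - (x::'a::ring_1) ^ n"
proof (induction n)
  case (Suc n)
  have "(1 - x) * (\<Sum>j<Suc n. x ^ j) = (1 - x) * (\<Sum>j<n. x ^ j) + (1 - x) * x ^ n"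
    by (simp add: distrib_left)
  then show ?case unfolding Suc.IH by (simp add: left_diff_distrib)
qed simp

text \<open>The spectral radius formula is needed only for spectrum \<open>{0}\<close>, where the resolvent
  \<open>R z = (1 - z *\<^sub>C T)\<^sup>-\<^sup>1\<close> exists on the whole plane. Instead of contour integrals the argument
  uses means of \<open>R\<close> over roots of unity.\<close>

definition resolvent_family :: "'a::cstar_algebra \<Rightarrow> (complex \<Rightarrow> 'a) \<Rightarrow> bool" where
  "resolvent_family T R \<longleftrightarrow> (\<forall>z. (1 - z *\<^sub>C T) * R z = 1 \<and> R z * (1 - z *\<^sub>C T) = 1)"

lemma quasinilpotent_resolvent:
  assumes "quasinilpotent T"
  obtains R where "resolvent_family T R"
proof -
  have "\<exists>y. (1 - z *\<^sub>C T) * y = 1 \<and> y * (1 - z *\<^sub>C T) = 1" for z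
  proof (cases "z = 0")
    case True
    then show ?thesis by (intro exI[of _ 1]) simp
  next
    case False
    then have "1 / z \<notin> spectrum T"
      using assms by (simp add: quasinilpotent_def)
    then obtain y where y: "((1/z) *\<^sub>C 1 - T) * y = 1" "y * ((1/z) *\<^sub>C 1 - T) = 1"
      unfolding spectrum_def invertible_in_def by blast
    have e: "1 - z *\<^sub>C T = z *\<^sub>C ((1/z) *\<^sub>C 1 - T)"
      using False by (simp add: scaleC_diff_right scaleC_scaleC)
    have "(1 - z *\<^sub>C T) * ((1/z) *\<^sub>C y) = 1 \<and> ((1/z) *\<^sub>C y) * (1 - z *\<^sub>C T) = 1"
      unfolding e scaleC_mult_left scaleC_mult_right scaleC_scaleC y using False by simp
    then show ?thesis by blast
  qed
  then have "\<forall>z. \<exists>y. (1 - z *\<^sub>C T) * y = 1 \<and> y * (1 - z *\<^sub>C T) = 1" by blast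
  from choice[OF this] have "\<exists>R. resolvent_family T R"
    unfolding resolvent_family_def .
  then show thesis using that by blast
qed

lemma resolvent_diff:
  assumes "resolvent_family T R"
  shows "R z - R w = (z - w) *\<^sub>C (R z * T * R w)"
proof -
  have e: "(1 - w *\<^sub>C T) - (1 - z *\<^sub>C T) = (z - w) *\<^sub>C T"
    using scaleC_add_left[of z "-w" T] by (simp add: scaleC_minus_left)
  have "(z - w) *\<^sub>C (R z * T * R w) = R z * ((1 - w *\<^sub>C T) - (1 - z *\<^sub>C T)) * R w"
    by (simp only: e scaleC_mult_left scaleC_mult_right)
  also have "\<dots> = R z * ((1 - w *\<^sub>C T) * R w) - (R z * (1 - z *\<^sub>C T)) * R w"
    by (simp only: right_diff_distrib left_diff_distrib mult.assoc)
  also have "\<dots> = R z - R w"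
    using assms unfolding resolvent_family_def by (metis mult_1_left mult_1_right)
  finally show ?thesis by (rule sym)
qed

lemma continuous_on_resolvent:
  assumes R: "resolvent_family T R"
  shows "continuous_on UNIV R"
proof -
  have "isCont R w" for w
  proof -
    define M where "M = norm T * norm (R w)"
    have M: "M \<ge> 0" by (simp add: M_def)
    have bound: "norm (R z - R w) \<le> cmod (z - w) * (norm (R z) * M)" for z
    proof -
      have "norm (R z * (T * R w)) \<le> norm (R z) * norm (T * R w)" by (rule norm_mult_ineq)
      also have "\<dots> \<le> norm (R z) * M"
        unfolding M_def by (intro mult_left_mono norm_mult_ineq norm_ge_zero)
      finally have "norm (R z * T * R w) \<le> norm (R z) * M" by (simp only: mult.assoc)
      then show ?thesis
        unfolding resolvent_diff[OF R, of z w] norm_scaleC by (rule mult_left_mono) simp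
    qed
    have "((\<lambda>z. cmod (z - w) * M) \<longlongrightarrow> cmod (w - w) * M) (at w)"
      by (intro tendsto_intros)
    then have "eventually (\<lambda>z. cmod (z - w) * M < 1 / 2) (at w)"
      by (rule order_tendstoD(2)) simp
    then have ev: "eventually (\<lambda>z. norm (R z - R w) \<le> cmod (z - w) * (2 * norm (R w) * M)) (at w)"
    proof eventually_elim
      case (elim z)
      have "norm (R z) \<le> norm (R w) + norm (R z - R w)"
        by (metis norm_triangle_sub)
      also have "norm (R z - R w) \<le> norm (R z) * (cmod (z - w) * M)"
        using bound[of z] by (simp add: mult_ac)
      also have "\<dots> \<le> norm (R z) * (1 / 2)"
        by (rule mult_left_mono) (use elim in auto)
      finally have "norm (R z) \<le> 2 * norm (R w)" by simp
      then have "cmod (z - w) * (norm (R z) * M) \<le> cmod (z - w) * (2 * norm (R w) * M)"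
        by (intro mult_left_mono mult_right_mono M) auto
      then show ?case using bound[of z] by simp
    qed
    have "((\<lambda>z. cmod (z - w) * (2 * norm (R w) * M)) \<longlongrightarrow> cmod (w - w) * (2 * norm (R w) * M)) (at w)"
      by (intro tendsto_intros)
    then have "((\<lambda>z. R z - R w) \<longlongrightarrow> 0) (at w)"
      by (intro Lim_null_comparison[OF ev]) simp
    then show ?thesis by (simp add: isCont_def LIM_zero_iff)
  qed
  then show ?thesis by (simp add: continuous_at_imp_continuous_on)
qed

lemma sum_powers_root_of_unity:
  assumes "0 < j" "j < n"
  shows "(\<Sum>k<n. (cis (2 * pi / n) ^ k) ^ j) = 0"
proof -
  define \<omega> where "\<omega> = cis (2 * pi / n)"
  have w: "\<omega> ^ j = cis (2 * pi * j / n)" by (simp add: \<omega>_def Complex.DeMoivre mult_ac)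
  have "\<omega> ^ n = 1" using assms by (simp add: \<omega>_def Complex.DeMoivre)
  moreover have "(\<omega> ^ j) ^ n = (\<omega> ^ n) ^ j" by (simp only: mult.commute flip: power_mult)
  ultimately have 1: "(\<omega> ^ j) ^ n = 1" by simp
  have 2: "\<omega> ^ j \<noteq> 1"
  proof
    assume "\<omega> ^ j = 1"
    then have "cis (2 * pi * j / n) = cis 0" using w by simp
    then have "cos (2 * pi * j / n) = 1" by (simp add: complex_eq_iff)
    then obtain m :: int where "2 * pi * j / n = of_int m * 2 * pi"
      unfolding cos_one_2pi_int by blast
    then have "(2 * pi) * (real j / n) = (2 * pi) * of_int m" by (simp only: mult_ac times_divide_eq_right)
    then have "real j / n = of_int m" by (simp only: mult_cancel_left) simp
    moreover have "0 < real j / n" "real j / n < 1" using assms by auto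
    ultimately show False by simp
  qed
  have "(\<Sum>k<n. (\<omega> ^ k) ^ j) = (\<Sum>k<n. (\<omega> ^ j) ^ k)"
    by (simp add: mult.commute flip: power_mult)
  also have "\<dots> = 0" using 1 2 by (simp add: geometric_sum)
  finally show ?thesis unfolding \<omega>_def .
qed

definition resolvent_mean :: "(complex \<Rightarrow> 'a::cstar_algebra) \<Rightarrow> nat \<Rightarrow> complex \<Rightarrow> 'a" where
  "resolvent_mean R n z = (1 / real n) *\<^sub>R (\<Sum>k<n. R (cis (2 * pi / n) ^ k * z))"

text \<open>The mean of \<open>R\<close> over the points \<open>\<omega> ^ k * z\<close> is the inverse of \<open>1 - z ^ n *\<^sub>C T ^ n\<close>: one has
  \<open>R \<zeta> * (1 - \<zeta> ^ n *\<^sub>C T ^ n) = (\<Sum>j<n. \<zeta> ^ j *\<^sub>C T ^ j)\<close>, and averaging over the points leaves only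
  the term \<open>j = 0\<close>.\<close>

lemma resolvent_mean_inverse:
  assumes R: "resolvent_family T R" and n: "n > 0"
  shows "resolvent_mean R n z * (1 - z ^ n *\<^sub>C T ^ n) = 1"
proof -
  define \<omega> where "\<omega> = cis (2 * pi / n)"
  have w: "\<omega> ^ n = 1" using n by (simp add: \<omega>_def Complex.DeMoivre)
  have "R (\<omega> ^ k * z) * (1 - z ^ n *\<^sub>C T ^ n) = (\<Sum>j<n. (\<omega> ^ k) ^ j *\<^sub>C (z ^ j *\<^sub>C T ^ j))" for k
  proof -
    let ?x = "(\<omega> ^ k * z) *\<^sub>C T"
    have "(\<omega> ^ k) ^ n = (\<omega> ^ n) ^ k" by (simp only: mult.commute flip: power_mult)
    then have "(\<omega> ^ k * z) ^ n = z ^ n" using w by (simp add: power_mult_distrib)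
    then have "1 - z ^ n *\<^sub>C T ^ n = 1 - ?x ^ n" by (simp add: power_scaleC)
    also have "\<dots> = (1 - ?x) * (\<Sum>j<n. ?x ^ j)" by (simp add: one_minus_mult_geometric_sum)
    finally have "R (\<omega> ^ k * z) * (1 - z ^ n *\<^sub>C T ^ n) = (R (\<omega> ^ k * z) * (1 - ?x)) * (\<Sum>j<n. ?x ^ j)"
      by (simp add: mult.assoc)
    also have "\<dots> = (\<Sum>j<n. ?x ^ j)" using R by (simp add: resolvent_family_def)
    finally show ?thesis by (simp add: power_scaleC scaleC_scaleC power_mult_distrib)
  qed
  then have "(\<Sum>k<n. R (\<omega> ^ k * z)) * (1 - z ^ n *\<^sub>C T ^ n) =
      (\<Sum>k<n. \<Sum>j<n. (\<omega> ^ k) ^ j *\<^sub>C (z ^ j *\<^sub>C T ^ j))"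
    by (simp add: sum_distrib_right)
  also have "\<dots> = (\<Sum>j<n. \<Sum>k<n. (\<omega> ^ k) ^ j *\<^sub>C (z ^ j *\<^sub>C T ^ j))"
    by (rule sum.swap)
  also have "\<dots> = (\<Sum>j<n. (\<Sum>k<n. (\<omega> ^ k) ^ j) *\<^sub>C (z ^ j *\<^sub>C T ^ j))"
    by (simp add: scaleC_sum_left)
  also have "\<dots> = (\<Sum>j<n. if j = 0 then complex_of_real n *\<^sub>C 1 else 0)"
    by (rule sum.cong) (auto simp: \<omega>_def sum_powers_root_of_unity)
  also have "\<dots> = real n *\<^sub>R 1"
    using n by (simp add: scaleR_eq_scaleC)
  finally show ?thesis using n by (simp add: resolvent_mean_def \<omega>_def)
qed

lemma resolvent_mean_dist_le:
  assumes "n > 0" "\<And>k. norm (R (cis (2 * pi / n) ^ k * z) - R (cis (2 * pi / n) ^ k * w)) \<le> e"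
  shows "norm (resolvent_mean R n z - resolvent_mean R n w) \<le> e"
proof -
  have "norm (\<Sum>k<n. R (cis (2 * pi / n) ^ k * z) - R (cis (2 * pi / n) ^ k * w)) \<le> (\<Sum>k<n. e)"
    by (rule sum_norm_le) (rule assms(2))
  then have "norm (\<Sum>k<n. R (cis (2 * pi / n) ^ k * z) - R (cis (2 * pi / n) ^ k * w)) \<le> real n * e"
    by simp
  then show ?thesis using assms(1)
    by (simp add: resolvent_mean_def sum_subtractf divide_simps mult.commute flip: scaleR_diff_right)
qed

lemma tendsto_0_scaled_power_norm:
  fixes a :: "nat \<Rightarrow> real"
  assumes a: "eventually (\<lambda>n. r' ^ n * a n \<le> C) sequentially" "\<And>n. a n \<ge> 0" and r: "0 \<le> r" "r < r'"
  shows "(\<lambda>n. r ^ n * a n) \<longlonglongrightarrow> 0"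
proof (rule Lim_null_comparison)
  show "eventually (\<lambda>n. norm (r ^ n * a n) \<le> C * (r / r') ^ n) sequentially"
    using a(1)
  proof eventually_elim
    case (elim n)
    have "r ^ n * a n = (r' ^ n * a n) * (r / r') ^ n" using r by (simp add: power_divide)
    also have "\<dots> \<le> C * (r / r') ^ n" by (rule mult_right_mono[OF elim]) (use r in simp)
    finally show ?case using a(2)[of n] r by simp
  qed
  have "(\<lambda>n. (r / r') ^ n) \<longlonglongrightarrow> 0" by (rule LIMSEQ_power_zero) (use r in simp)
  then show "(\<lambda>n. C * (r / r') ^ n) \<longlonglongrightarrow> 0" by (rule tendsto_mult_right_zero)
qed

text \<open>Decay of \<open>r ^ n * norm (T ^ n)\<close> puts the mean at \<open>r\<close> near \<open>1\<close>. Uniform continuity of \<open>R\<close> keeps the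
  mean at \<open>r'\<close> near \<open>1\<close>, for all \<open>n\<close> at once, so its inverse \<open>1 - r' ^ n *\<^sub>R T ^ n\<close> stays bounded. The
  admissible step \<open>\<delta>\<close> depends on \<open>\<rho>\<close> only, so that finitely many steps reach every radius.\<close>

lemma quasinilpotent_power_step:
  fixes T :: "'a::cstar_algebra"
  assumes R: "resolvent_family T R"
    and cont: "\<And>z w. cmod z \<le> \<rho> \<Longrightarrow> cmod w \<le> \<rho> \<Longrightarrow> cmod (z - w) < \<delta> \<Longrightarrow> norm (R z - R w) \<le> 1 / 4"
    and r: "0 \<le> r" "r \<le> r'" "r' < r + \<delta>" "r' \<le> \<rho>"
    and lim: "(\<lambda>n. r ^ n * norm (T ^ n)) \<longlonglongrightarrow> 0"
  shows "eventually (\<lambda>n. r' ^ n * norm (T ^ n) \<le> 3) sequentially"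
proof -
  have "eventually (\<lambda>n. r ^ n * norm (T ^ n) < 1 / 8) sequentially"
    by (rule order_tendstoD(2)[OF lim]) simp
  then show ?thesis using eventually_gt_at_top[of 0]
  proof eventually_elim
    case (elim n)
    let ?F = "\<lambda>s. resolvent_mean R n (complex_of_real s)"
    let ?y = "\<lambda>s. complex_of_real s ^ n *\<^sub>C T ^ n"
    have F: "?F s * (1 - ?y s) = 1" for s by (rule resolvent_mean_inverse[OF R elim(2)])
    have ny: "norm (?y s) = s ^ n * norm (T ^ n)" if "s \<ge> 0" for s
      using that by (simp add: norm_scaleC norm_power)
    \<comment> \<open>Both \<open>?F r - 1\<close> and \<open>?F r' - ?F r\<close> are at most \<open>1/4\<close>. Thus \<open>?F r'\<close> is within \<open>1/2\<close> of \<open>1\<close>, its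
      inverse \<open>1 - ?y r'\<close> has norm at most \<open>2\<close>, and \<open>?y r'\<close> at most \<open>3\<close>.\<close>
    have "?F r * 1 - ?F r * ?y r = 1" using F[of r] by (simp only: right_diff_distrib)
    then have "?F r - 1 = ?F r * ?y r" by (simp add: algebra_simps)
    then have "norm (?F r - 1) \<le> norm (?F r) * norm (?y r)" by (simp add: norm_mult_ineq)
    also have "\<dots> \<le> norm (?F r) * (1 / 8)"
      by (rule mult_left_mono) (use elim ny r in auto)
    finally have 1: "norm (?F r - 1) \<le> norm (?F r) * (1 / 8)" .
    moreover have "norm (?F r) \<le> 1 + norm (?F r - 1)"
      using norm_triangle_sub[of "?F r" 1] by simp
    ultimately have a: "norm (?F r - 1) \<le> 1 / 4" by simp
    have b: "norm (?F r' - ?F r) \<le> 1 / 4"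
    proof (rule resolvent_mean_dist_le[OF elim(2)], rule cont)
      fix k
      let ?w = "cis (2 * pi / n) ^ k"
      have "?w * of_real r' - ?w * of_real r = ?w * of_real (r' - r)"
        by (simp add: algebra_simps)
      then show "cmod (?w * of_real r' - ?w * of_real r) < \<delta>"
        using r by (simp add: norm_mult norm_power del: of_real_diff)
    qed (use r in \<open>auto simp: norm_mult norm_power\<close>)
    have "norm (?F r' - 1) \<le> 1 / 2"
      using norm_triangle_ineq[of "?F r' - ?F r" "?F r - 1"] a b by simp
    then have "norm (1 - ?F r') \<le> 1 / 2" by (simp add: norm_minus_commute)
    moreover have e: "1 - ?y r' = 1 + (1 - ?F r') * (1 - ?y r')"
      using F[of r'] by (simp add: left_diff_distrib)
    have "norm (1 - ?y r') \<le> 1 + norm ((1 - ?F r') * (1 - ?y r'))"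
      using norm_triangle_ineq[of 1 "(1 - ?F r') * (1 - ?y r')"] by (simp only: norm_one flip: e)
    moreover have "norm ((1 - ?F r') * (1 - ?y r')) \<le> norm (1 - ?F r') * norm (1 - ?y r')"
      by (rule norm_mult_ineq)
    moreover have "norm (1 - ?F r') * norm (1 - ?y r') \<le> 1 / 2 * norm (1 - ?y r')"
      if "norm (1 - ?F r') \<le> 1 / 2" by (rule mult_right_mono[OF that]) simp
    ultimately have "norm (1 - ?y r') \<le> 2" by simp
    then have "norm (?y r') \<le> 3"
      using norm_triangle_ineq4[of 1 "1 - ?y r'"] by simp
    then show ?case using ny[of r'] r by simp
  qed
qed

lemma quasinilpotent_summable:
  fixes T :: "'a::cstar_algebra"
  assumes T: "quasinilpotent T" and r: "r \<ge> 0"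
  shows "summable (\<lambda>n. r ^ n * norm (T ^ n))"
proof -
  obtain R where R: "resolvent_family T R" using quasinilpotent_resolvent[OF T] .
  (* any radius beyond r would do: decay at s gives geometric decay at r *)
  define s where "s = 2 * r + 1"
  have s: "s > 0" "r < s" using r by (auto simp: s_def)
  have "uniformly_continuous_on (cball 0 (s + 1)) R"
    by (intro compact_uniformly_continuous continuous_on_subset[OF continuous_on_resolvent[OF R]]) auto
  then obtain d where d: "d > 0"
    "\<And>z w. z \<in> cball 0 (s + 1) \<Longrightarrow> w \<in> cball 0 (s + 1) \<Longrightarrow> dist w z < d \<Longrightarrow> dist (R w) (R z) < 1 / 4"
    by (rule uniformly_continuous_onE[of _ _ "1/4"]) auto
  define \<delta> where "\<delta> = min d 1"
  have \<delta>: "0 < \<delta>" "\<delta> \<le> 1" "\<delta> \<le> d" using d by (auto simp: \<delta>_def)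
  have cont: "norm (R z - R w) \<le> 1 / 4" if "cmod z \<le> s + 1" "cmod w \<le> s + 1" "cmod (z - w) < \<delta>" for z w
    using d(2)[of w z] that \<delta> by (simp add: dist_norm)
  have good: "(\<lambda>n. min (real m * (\<delta> / 2)) s ^ n * norm (T ^ n)) \<longlonglongrightarrow> 0" for m
  proof (induction m)
    case 0
    have "eventually (\<lambda>n. 0 = (0::real) ^ n * norm (T ^ n)) sequentially"
      using eventually_gt_at_top[of 0] by eventually_elim simp
    then show ?case using s by (simp add: tendsto_eventually[of _ 0] eventually_mono)
  next
    case (Suc m)
    let ?r = "min (real m * (\<delta> / 2)) s"
    (* the bound obtained at ?r + 3/4 * \<delta> becomes decay at the smaller radius ?r + \<delta>/2 *)
    have "eventually (\<lambda>n. (?r + 3 / 4 * \<delta>) ^ n * norm (T ^ n) \<le> 3) sequentially"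
      by (rule quasinilpotent_power_step[OF R cont _ _ _ _ Suc.IH]) (use s \<delta> in auto)
    then show ?case
    proof (rule tendsto_0_scaled_power_norm)
      show "min (real (Suc m) * (\<delta> / 2)) s < ?r + 3 / 4 * \<delta>"
        using \<delta> by (auto simp: min_def algebra_simps)
    qed (use s \<delta> in auto)
  qed
  obtain m :: nat where "s / (\<delta> / 2) \<le> real m" using real_arch_simple by blast
  then have "s \<le> real m * (\<delta> / 2)" using \<delta> by (simp add: divide_simps)
  then have "(\<lambda>n. s ^ n * norm (T ^ n)) \<longlonglongrightarrow> 0" using good[of m] by (simp add: min_absorb2)
  then have "Bseq (\<lambda>n. s ^ n * norm (T ^ n))" by (intro convergent_imp_Bseq convergentI)
  then obtain K where K: "\<And>n. norm (s ^ n * norm (T ^ n)) \<le> K" by (auto simp: Bseq_def)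
  have geo: "summable (\<lambda>n. K * (r / s) ^ n)"
    by (intro summable_mult summable_geometric) (use s r in auto)
  have "norm (r ^ n * norm (T ^ n)) \<le> K * (r / s) ^ n" for n
  proof -
    have "r ^ n * norm (T ^ n) = (s ^ n * norm (T ^ n)) * (r / s) ^ n" using s by (simp add: power_divide)
    also have "\<dots> \<le> K * (r / s) ^ n" by (rule mult_right_mono) (use K[of n] s r in auto)
    finally show ?thesis using r by simp
  qed
  then show ?thesis by (intro summable_comparison_test'[OF geo, of 0])
qed

section \<open>Conditional expectations onto a commutative subalgebra\<close>

locale commutative_ncps =
  fixes B :: "'a::cstar_algebra set" and E :: "'a \<Rightarrow> 'a"
  assumes ncps: "cstar_ncps B E"
    and B_commute: "\<And>x y. x \<in> B \<Longrightarrow> y \<in> B \<Longrightarrow> x * y = y * x"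
begin

lemma B_subalgebra: "unital_cstar_subalgebra B"
  using ncps by (simp add: cstar_ncps_def)

lemmas B_closed = cstar_subalgebraD[OF B_subalgebra]

lemma E_add: "E (x + y) = E x + E y"
  and E_scaleC: "E (c *\<^sub>C x) = c *\<^sub>C E x"
  and E_in_B [simp]: "E x \<in> B"
  and E_of_B: "b \<in> B \<Longrightarrow> E b = b"
  and E_bimodule: "b \<in> B \<Longrightarrow> b' \<in> B \<Longrightarrow> E (b * x * b') = b * E x * b'"
  and E_le: "le_in B 0 (E (star x * x))"
  and norm_E_le: "norm (E x) \<le> norm x"
  using ncps by (auto simp: cstar_ncps_def conditional_expectation_def)

lemma E_mult_left: "b \<in> B \<Longrightarrow> E (b * x) = b * E x"
  using E_bimodule[of b 1 x] B_closed(2) by simp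

lemma E_mult_right: "b \<in> B \<Longrightarrow> E (x * b) = E x * b"
  using E_bimodule[of 1 b x] B_closed(2) by simp

lemma E_scaleR: "E (r *\<^sub>R x) = r *\<^sub>R E x"
  by (simp add: scaleR_eq_scaleC E_scaleC)

lemma E_minus: "E (- x) = - E x"
  using E_scaleR[of "-1" x] by simp

lemma E_diff: "E (x - y) = E x - E y"
  using E_add[of x "- y"] by (simp add: E_minus)

lemma E_zero [simp]: "E 0 = 0"
  using E_scaleR[of 0 0] by simp

lemma E_one [simp]: "E 1 = 1"
  by (rule E_of_B[OF B_closed(2)])

lemma E_sum: "E (\<Sum>i\<in>I. f i) = (\<Sum>i\<in>I. E (f i))"
  by (induction I rule: infinite_finite_induct) (simp_all add: E_add)

lemma bounded_linear_E: "bounded_linear E"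
  by (rule bounded_linear_intro[where K=1]) (simp_all add: E_add E_scaleR norm_E_le)

lemma positive_star_mult_in_B:
  assumes "c \<in> B" shows "positive (star c * c)"
  using assms by (intro positive_star_mult_of_normal B_commute B_closed)

lemma E_positive: "positive (E (star x * x))"
proof -
  obtain c where "c \<in> B" "E (star x * x) = star c * c"
    using E_le[of x] by (auto simp: le_in_def)
  then show ?thesis by (simp add: positive_star_mult_in_B)
qed

text \<open>Polarisation: \<open>E (star y * y)\<close> is selfadjoint for \<open>y\<close>, \<open>1 + y\<close> with \<open>y = x\<close> and \<open>y = \<i> *\<^sub>C x\<close>.\<close>

lemma E_star: "E (star x) = star (E x)"
proof -
  have sa: "star (E (star y * y)) = E (star y * y)" for y
    using E_positive[of y] by (simp add: positive_def)
  have key: "star (E y) + star (E (star y)) = E y + E (star y)" for y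
  proof -
    have "star (1 + y) * (1 + y) = 1 + (y + star y) + star y * y"
      by (simp add: star_add distrib_left distrib_right add_ac)
    then have "E (star (1 + y) * (1 + y)) = 1 + (E y + E (star y)) + E (star y * y)"
      by (simp add: E_add)
    then have "star (1 + (E y + E (star y)) + E (star y * y)) = 1 + (E y + E (star y)) + E (star y * y)"
      using sa[of "1 + y"] by simp
    then show ?thesis using sa[of y] by (simp add: star_add)
  qed
  have 1: "star (E x) + star (E (star x)) = E x + E (star x)" by (rule key)
  have "(-\<i>) *\<^sub>C (star (E x) - star (E (star x))) = \<i> *\<^sub>C (E x - E (star x))"
    using key[of "\<i> *\<^sub>C x"]
    by (simp add: E_scaleC star_scaleC scaleC_minus_left scaleC_diff_right E_minus star_minus)
  then have "\<i> *\<^sub>C ((-\<i>) *\<^sub>C (star (E x) - star (E (star x)))) = \<i> *\<^sub>C (\<i> *\<^sub>C (E x - E (star x)))"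
    by (rule arg_cong)
  then have 2: "star (E x) - star (E (star x)) = E (star x) - E x"
    by (simp only: scaleC_scaleC) (simp add: scaleC_minus_left)
  have "2 *\<^sub>R star (E x) = (star (E x) + star (E (star x))) + (star (E x) - star (E (star x)))"
    by (simp add: scaleR_2)
  also have "\<dots> = 2 *\<^sub>R E (star x)" unfolding 1 2 by (simp add: scaleR_2)
  finally show ?thesis by simp
qed

text \<open>Left multiplication by \<open>a\<close> is bounded by \<open>norm a\<close> in \<open>L\<^sup>2(E)\<close>. If \<open>R = (norm a)\<^sup>2\<close>, then
  \<open>R - star a * a = R *\<^sub>R (r * r)\<close> for a selfadjoint \<open>r\<close>, so the difference is a multiple of
  \<open>E (star (r * y) * (r * y))\<close>.\<close>

lemma L2_operator_bound:
  fixes a y :: 'a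
  shows "positive ((norm a)\<^sup>2 *\<^sub>R E (star y * y) - E (star (a * y) * (a * y)))"
proof (cases "a = 0")
  case False
  define R where "R = (norm a)\<^sup>2"
  have R: "R > 0" using False by (simp add: R_def)
  define h where "h = (1 / R) *\<^sub>R (star a * a)"
  have "star (1 - h) = 1 - h" by (simp add: h_def star_diff star_scaleR star_mult star_star)
  moreover have "norm (1 - (1 - h)) \<le> 1"
    using R cstar_identity[of a] by (simp add: h_def R_def)
  ultimately obtain r where r: "star r = r" "r * r = 1 - h"
    by (rule cstar_sqrt_exists[OF cstar_subalgebra_UNIV UNIV_I])
  have "R *\<^sub>R (star (r * y) * (r * y)) = R *\<^sub>R (star y * (r * r) * y)"
    by (simp add: star_mult r(1) mult.assoc)
  also have "\<dots> = R *\<^sub>R (star y * y) - star (a * y) * (a * y)"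
    unfolding r(2) h_def using R
    by (simp add: left_diff_distrib right_diff_distrib scaleR_right_diff_distrib star_mult mult.assoc)
  finally have "R *\<^sub>R E (star (r * y) * (r * y)) = R *\<^sub>R E (star y * y) - E (star (a * y) * (a * y))"
    by (metis E_diff E_scaleR)
  moreover have "positive (R *\<^sub>R E (star (r * y) * (r * y)))"
    using R by (intro positive_scaleR E_positive) simp
  ultimately show ?thesis by (simp add: R_def)
qed (simp add: E_positive)

text \<open>Conversely, if the representation of \<open>D\<close> on \<open>L\<^sup>2(D, E)\<close> is faithful, a bound there is a bound in
  norm. For \<open>q' > q\<close> let \<open>f\<close> be twice the positive part of \<open>p * p - q'\<close>. On the range of \<open>f\<close> the operator
  \<open>p * p\<close> is at least \<open>q'\<close>, so the assumed bound leaves no room and forces \<open>f * x\<close> to vanish in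
  \<open>L\<^sup>2(D, E)\<close> for all \<open>x\<close>. Faithfulness gives \<open>f = 0\<close>, that is, \<open>q' - p * p\<close> is positive.\<close>

lemma norm_le_of_L2_operator_bound:
  assumes D: "unital_cstar_subalgebra D" and faithful: "gns_faithful_on D E"
    and p: "p \<in> D" "star p = p" and q: "q \<ge> 0"
    and bound: "\<And>x. x \<in> D \<Longrightarrow> positive (q *\<^sub>R E (star x * x) - E (star (p * x) * (p * x)))"
  shows "(norm p)\<^sup>2 \<le> q"
proof (rule dense_ge)
  fix q' assume q': "q < q'"
  note Dd = cstar_subalgebraD[OF D]
  define y where "y = p * p - q' *\<^sub>R 1"
  have yD: "y \<in> D" and ysa: "star y = y"
    using p by (auto simp: y_def star_diff star_mult star_scaleR intro!: Dd)
  have yyD: "y * y \<in> D" by (intro Dd yD)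
  \<comment> \<open>\<open>a\<close> is the absolute value of \<open>y\<close>, and \<open>r\<close> its root\<close>
  obtain a where a: "a \<in> D" "positive a" "star a = a" "a * a = y * y"
    and a_comm: "\<And>z. z * (y * y) = (y * y) * z \<Longrightarrow> z * a = a * z"
    by (rule positive_sqrt[OF D yyD positive_square[OF ysa]]) blast
  obtain r where r: "r \<in> D" "star r = r" "r * r = a"
    and r_comm: "\<And>z. z * a = a * z \<Longrightarrow> z * r = r * z"
    by (rule positive_sqrt[OF D a(1,2)]) blast
  have ya: "y * a = a * y" by (rule a_comm) (simp only: mult.assoc)
  have yr: "y * r = r * y" by (rule r_comm[OF ya])
  have ar: "a * r = r * a" by (rule r_comm) (rule refl)
  define f where "f = a + y"
  have fD: "f \<in> D" and fsa: "star f = f"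
    using a(1,3) yD ysa by (auto simp: f_def star_add intro!: Dd)
  have fr: "f * r = r * f" by (simp only: f_def distrib_left distrib_right ar yr)
  have fa: "f * a = a * f" by (simp only: f_def distrib_left distrib_right ya)
  have yf: "y * f = a * f" by (simp only: f_def distrib_left ya a(4) add.commute)
  have pp: "p * p = q' *\<^sub>R 1 + y" by (simp add: y_def)
  have fpf: "f * (p * p) * f = q' *\<^sub>R (f * f) + (r * f) * (r * f)"
  proof -
    have "f * (p * p) * f = q' *\<^sub>R (f * f) + f * (y * f)"
      by (simp add: pp distrib_left distrib_right mult.assoc)
    also have "f * (y * f) = (f * r) * (r * f)"
      by (simp only: yf mult.assoc flip: r(3))
    finally show ?thesis by (simp only: fr)
  qed
  have "f = 0"
  proof -
    have "E (star (f * x) * (f * x)) = 0" if x: "x \<in> D" for x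
    proof -
      let ?X = "E (star (f * x) * (f * x))"
      let ?W = "q *\<^sub>R ?X - E (star (p * (f * x)) * (p * (f * x)))"
      let ?Y = "E (star (r * (f * x)) * (r * (f * x)))"
      have W: "positive ?W" by (intro bound Dd fD x)
      have "star (p * (f * x)) * (p * (f * x)) = star x * (f * (p * p) * f) * x"
        by (simp only: star_mult fsa p(2) mult.assoc)
      also have "\<dots> = q' *\<^sub>R (star x * (f * f) * x) + star x * ((r * f) * (r * f)) * x"
        unfolding fpf by (simp add: distrib_left distrib_right)
      also have "star x * (f * f) * x = star (f * x) * (f * x)"
        by (simp only: star_mult fsa mult.assoc)
      also have "star x * ((r * f) * (r * f)) * x = star x * ((f * r) * (r * f)) * x"
        by (simp only: fr)
      also have "\<dots> = star (r * (f * x)) * (r * (f * x))"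
        by (simp only: star_mult fsa r(2) mult.assoc)
      finally have "E (star (p * (f * x)) * (p * (f * x))) = q' *\<^sub>R ?X + ?Y"
        by (simp add: E_add E_scaleR)
      then have "(q' - q) *\<^sub>R ?X + (?W + ?Y) = 0"
        by (simp add: scaleR_left_diff_distrib)
      moreover have "positive ((q' - q) *\<^sub>R ?X)" using q' by (intro positive_scaleR E_positive) simp
      moreover have "positive (?W + ?Y)" by (intro positive_add W E_positive)
      ultimately have "(q' - q) *\<^sub>R ?X = 0" by (metis positive_add_eq_0)
      then show ?thesis using q' by simp
    qed
    then show "f = 0" using faithful fD by (auto simp: gns_faithful_on_def)
  qed
  then have "y = - a" by (simp add: f_def eq_neg_iff_add_eq_0 add.commute)
  then have sum: "p * p + r * r = q' *\<^sub>R 1" using pp by (simp add: r(3))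
  have "p * y = y * p" by (simp add: y_def left_diff_distrib right_diff_distrib mult.assoc)
  then have "p * (y * y) = (y * y) * p" by (metis mult.assoc)
  then have "p * r = r * p" by (intro r_comm a_comm)
  then have "norm (p * p) \<le> norm (p * p + r * r)"
    by (rule norm_le_of_sum_of_commuting_squares[OF p(2) r(2)])
  also have "\<dots> = q'" unfolding sum using q q' by simp
  finally show "(norm p)\<^sup>2 \<le> q'" using norm_square_of_selfadjoint[OF p(2)] by simp
qed

end

section \<open>Words in a circular element\<close>

text \<open>A letter stands for \<open>T\<close> or \<open>star T\<close> between two coefficients. Coefficients on both sides let
  the unitaries of a twist be inserted on either side without leaving the format.\<close>

datatype 'b letter = Letter (starred: bool) (lcoef: 'b) (rcoef: 'b)

definition letter_degree :: "'b letter \<Rightarrow> int" where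
  "letter_degree x = (if starred x then -1 else 1)"

definition word_degree :: "'b letter list \<Rightarrow> int" where
  "word_degree L = sum_list (map letter_degree L)"

lemma word_degree_simps [simp]:
  "word_degree [] = 0" "word_degree (x # L) = letter_degree x + word_degree L" "word_degree (L @ M) = word_degree L + word_degree M"
  by (simp_all add: word_degree_def)

lemma word_degree_split: "m < length L \<Longrightarrow> word_degree L = word_degree (take m L) + letter_degree (L ! m) + word_degree (drop (Suc m) L)"
  by (subst id_take_nth_drop[of m L]) simp_all

lemma letter_degree_opposite: "starred x \<noteq> starred y \<Longrightarrow> letter_degree x + letter_degree y = 0"
  by (auto simp: letter_degree_def)

locale circular = commutative_ncps B E for B :: "'a::cstar_algebra set" and E +
  fixes T :: 'a
  assumes circ: "B_circular B E T"
begin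

definition letter_value :: "'a letter \<Rightarrow> 'a" where
  "letter_value x = lcoef x * eps_power T (starred x) * rcoef x"

definition word_value :: "'a letter list \<Rightarrow> 'a" where
  "word_value L = prod_list (map letter_value L)"

definition coefs_in_B :: "'a letter list \<Rightarrow> bool" where
  "coefs_in_B L \<longleftrightarrow> (\<forall>x\<in>set L. lcoef x \<in> B \<and> rcoef x \<in> B)"

lemma word_value_simps [simp]:
  "word_value [] = 1" "word_value (x # L) = letter_value x * word_value L"
  "word_value (L @ M) = word_value L * word_value M"
  by (simp_all add: word_value_def)

lemma coefs_in_B_simps [simp]:
  "coefs_in_B []" "coefs_in_B (x # L) \<longleftrightarrow> lcoef x \<in> B \<and> rcoef x \<in> B \<and> coefs_in_B L"
  "coefs_in_B (L @ M) \<longleftrightarrow> coefs_in_B L \<and> coefs_in_B M"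
  by (auto simp: coefs_in_B_def)

lemma coefs_in_B_nth: "coefs_in_B L \<Longrightarrow> m < length L \<Longrightarrow> lcoef (L ! m) \<in> B \<and> rcoef (L ! m) \<in> B"
  by (simp add: coefs_in_B_def)

lemma coefs_in_B_take: "coefs_in_B L \<Longrightarrow> coefs_in_B (take m L)"
  and coefs_in_B_drop: "coefs_in_B L \<Longrightarrow> coefs_in_B (drop m L)"
  by (auto simp: coefs_in_B_def dest: in_set_takeD in_set_dropD)

lemma cov_in_B [simp]: "cov E T e x \<in> B"
  by (simp add: cov_def)

lemma cov_zero [simp]: "cov E T e 0 = 0"
  by (simp add: cov_def)

text \<open>The moment formula for words with coefficients on both sides. It reduces to the one with
  coefficients on the right: each left coefficient is absorbed by the preceding letter, and the
  left coefficient of the first letter of an inner word is pulled out of \<open>E\<close>.\<close>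

lemma moment_recursion:
  assumes ok: "coefs_in_B (x # L)"
  shows "E (word_value (x # L)) =
    (\<Sum>m \<in> {m. m < length L \<and> starred (L ! m) \<noteq> starred x}.
       lcoef x * cov E T (starred x) (rcoef x * E (word_value (take m L)) * lcoef (L ! m)) *
       rcoef (L ! m) * E (word_value (drop (Suc m) L)))"
proof -
  define W where "W = x # L"
  define n where "n = length W"
  define \<epsilon> where "\<epsilon> k = starred (W ! (k - 1))" for k
  (* l (Suc n) = 1 stands for the missing letter after the last one *)
  define l where "l k = (if k \<le> n then lcoef (W ! (k - 1)) else 1)" for k
  define b where "b k = rcoef (W ! (k - 1)) * l (Suc k)" for k
  define P where "P i j = prod_list (map (\<lambda>k. letter_value (W ! (k - 1))) [i..<Suc j])" for i j
  define Q where "Q i j = prod_list (map (\<lambda>k. eps_power T (\<epsilon> k) * b k) [i..<Suc j])" for i j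
  have lB: "l k \<in> B" if "k \<ge> 1" for k
    using that coefs_in_B_nth[OF ok, of "k - 1"] B_closed(2) by (auto simp: l_def n_def W_def)
  have rB: "rcoef (W ! (k - 1)) \<in> B" if "k \<ge> 1" "k \<le> n" for k
    using that coefs_in_B_nth[OF ok, of "k - 1"] by (auto simp: n_def W_def)
  have bB: "b k \<in> B" if "k \<in> {1..n}" for k
    using that lB[of "Suc k"] rB[of k] by (auto simp: b_def intro: B_closed)
  have shift: "P i j * l (Suc j) = l i * Q i j" if "1 \<le> i" "i \<le> Suc j" "j \<le> n" for i j
    using that
  proof (induction j)
    case 0
    then have "i = Suc 0" by simp
    then show ?case by (simp add: P_def Q_def)
  next
    case (Suc j)
    show ?case
    proof (cases "i = Suc (Suc j)")
      case True
      then show ?thesis by (simp add: P_def Q_def)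
    next
      case False
      then have le: "i \<le> Suc j" using Suc.prems by simp
      have "P i (Suc j) = P i j * letter_value (W ! j)" "Q i (Suc j) = Q i j * (eps_power T (\<epsilon> (Suc j)) * b (Suc j))"
        using le by (simp_all add: P_def Q_def)
      moreover have "letter_value (W ! j) * l (Suc (Suc j)) = l (Suc j) * (eps_power T (\<epsilon> (Suc j)) * b (Suc j))"
        using Suc.prems by (simp add: letter_value_def b_def l_def \<epsilon>_def mult.assoc)
      moreover have "P i j * l (Suc j) = l i * Q i j" using Suc.IH Suc.prems le by simp
      ultimately show ?thesis by (simp add: mult.assoc) (simp flip: mult.assoc)
    qed
  qed
  have EQ: "E (P i j) * l (Suc j) = l i * E (Q i j)" if "1 \<le> i" "i \<le> Suc j" "j \<le> n" for i j
    using that shift[of i j] lB by (simp flip: E_mult_left E_mult_right)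
  have Pword: "P i j = word_value (take (Suc j - i) (drop (i - 1) W))" if "1 \<le> i" "j \<le> n" for i j
  proof -
    have "map (\<lambda>k. letter_value (W ! (k - 1))) [i..<Suc j] = map letter_value (take (Suc j - i) (drop (i - 1) W))"
      using that by (intro nth_equalityI) (auto simp: n_def simp del: upt_Suc)
    then show ?thesis by (simp add: P_def word_value_def)
  qed
  have n1: "n \<ge> 1" by (simp add: n_def W_def)
  have "E (word_value W) = E (P 1 n) * l (Suc n)"
    using Pword[of 1 n] n1 by (simp add: l_def n_def)
  also have "\<dots> = l 1 * E (Q 1 n)" using EQ[of 1 n] by simp
  also have "E (Q 1 n) = word_moment E T \<epsilon> b 1 n" by (simp add: Q_def word_moment_def)
  also have "\<dots> = (\<Sum>j \<in> {j\<in>{2..n}. \<epsilon> j \<noteq> \<epsilon> 1}.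
      cov E T (\<epsilon> 1) (b 1 * word_moment E T \<epsilon> b 2 (j - 1)) * b j * word_moment E T \<epsilon> b (j + 1) n)"
    using circ n1 bB unfolding B_circular_def by blast
  also have "l 1 * \<dots> = (\<Sum>j \<in> {j\<in>{2..n}. \<epsilon> j \<noteq> \<epsilon> 1}.
      l 1 * (cov E T (\<epsilon> 1) (b 1 * word_moment E T \<epsilon> b 2 (j - 1)) * b j * word_moment E T \<epsilon> b (j + 1) n))"
    by (rule sum_distrib_left)
  also have "\<dots> = (\<Sum>j \<in> {j\<in>{2..n}. \<epsilon> j \<noteq> \<epsilon> 1}.
       lcoef x * cov E T (starred x) (rcoef x * E (word_value (take (j - 2) L)) * lcoef (L ! (j - 2))) *
       rcoef (L ! (j - 2)) * E (word_value (drop (j - 1) L)))"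
  proof (rule sum.cong[OF refl])
    fix j assume "j \<in> {j\<in>{2..n}. \<epsilon> j \<noteq> \<epsilon> 1}"
    then have j: "2 \<le> j" "j \<le> n" by auto
    obtain i where i: "j = Suc (Suc i)" using j by (metis One_nat_def Suc_1 Suc_le_D add_2_eq_Suc le_Suc_ex)
    have "b 1 * word_moment E T \<epsilon> b 2 (j - 1) = rcoef x * (l 2 * E (Q 2 (j - 1)))"
      by (simp add: b_def W_def Q_def word_moment_def mult.assoc numeral_2_eq_2)
    also have "l 2 * E (Q 2 (j - 1)) = E (P 2 (j - 1)) * l j"
      using EQ[of 2 "j - 1"] j by simp
    also have "P 2 (j - 1) = word_value (take (j - 2) L)"
      using Pword[of 2 "j - 1"] j by (simp add: W_def i)
    finally have 1: "b 1 * word_moment E T \<epsilon> b 2 (j - 1) = rcoef x * E (word_value (take (j - 2) L)) * lcoef (L ! (j - 2))"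
      using j by (simp add: mult.assoc l_def W_def i)
    have "b j * word_moment E T \<epsilon> b (j + 1) n = rcoef (W ! (j - 1)) * (l (Suc j) * E (Q (Suc j) n))"
      by (simp add: b_def Q_def word_moment_def mult.assoc)
    also have "l (Suc j) * E (Q (Suc j) n) = E (P (Suc j) n)"
      using EQ[of "Suc j" n] j by (simp add: l_def)
    also have "P (Suc j) n = word_value (drop (j - 1) L)"
      using Pword[of "Suc j" n] j by (simp add: W_def n_def i)
    finally have 2: "b j * word_moment E T \<epsilon> b (j + 1) n = rcoef (L ! (j - 2)) * E (word_value (drop (j - 1) L))"
      by (simp add: W_def i)
    show "l 1 * (cov E T (\<epsilon> 1) (b 1 * word_moment E T \<epsilon> b 2 (j - 1)) * b j * word_moment E T \<epsilon> b (j + 1) n) =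
       lcoef x * cov E T (starred x) (rcoef x * E (word_value (take (j - 2) L)) * lcoef (L ! (j - 2))) *
       rcoef (L ! (j - 2)) * E (word_value (drop (j - 1) L))"
      using n1 unfolding 1 mult.assoc[of _ "b j"] 2 by (simp add: \<epsilon>_def l_def W_def mult.assoc)
  qed
  also have "\<dots> = (\<Sum>m \<in> {m. m < length L \<and> starred (L ! m) \<noteq> starred x}.
       lcoef x * cov E T (starred x) (rcoef x * E (word_value (take m L)) * lcoef (L ! m)) *
       rcoef (L ! m) * E (word_value (drop (Suc m) L)))"
  proof (rule sum.reindex_bij_witness[where i = "\<lambda>m. m + 2" and j = "\<lambda>j. j - 2"])
    fix j assume j: "j \<in> {j\<in>{2..n}. \<epsilon> j \<noteq> \<epsilon> 1}"
    then obtain i where i: "j = i + 2" by (auto simp: le_iff_add add.commute)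
    show "j - 2 \<in> {m. m < length L \<and> starred (L ! m) \<noteq> starred x}"
      using j unfolding i by (auto simp: n_def \<epsilon>_def W_def)
    show "lcoef x * cov E T (starred x) (rcoef x * E (word_value (take (j - 2) L)) * lcoef (L ! (j - 2))) *
       rcoef (L ! (j - 2)) * E (word_value (drop (Suc (j - 2)) L)) =
       lcoef x * cov E T (starred x) (rcoef x * E (word_value (take (j - 2) L)) * lcoef (L ! (j - 2))) *
       rcoef (L ! (j - 2)) * E (word_value (drop (j - 1) L))"
      unfolding i by simp
  qed (auto simp: n_def \<epsilon>_def W_def Suc_diff_le numeral_2_eq_2)
  finally show ?thesis unfolding W_def .
qed

text \<open>In each term of the moment formula the paired letters have opposite degrees, so one of the two
  remaining subwords is unbalanced and shorter.\<close>

lemma E_word_unbalanced: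
  assumes "coefs_in_B L" "word_degree L \<noteq> 0"
  shows "E (word_value L) = 0"
  using assms
proof (induction L rule: length_induct)
  case (1 W)
  obtain x L where W: "W = x # L" using 1(3) by (cases W) auto
  have "E (word_value (take m L)) = 0 \<or> E (word_value (drop (Suc m) L)) = 0"
    if m: "m < length L" "starred (L ! m) \<noteq> starred x" for m
  proof -
    have "word_degree (take m L) \<noteq> 0 \<or> word_degree (drop (Suc m) L) \<noteq> 0"
      using word_degree_split[OF m(1)] letter_degree_opposite[OF m(2)] 1(3) by (auto simp: W)
    moreover have "length (take m L) < length W" "length (drop (Suc m) L) < length W"
      using m by (auto simp: W)
    moreover have "coefs_in_B (take m L)" "coefs_in_B (drop (Suc m) L)"
      using 1(2) by (auto simp: W intro: coefs_in_B_take coefs_in_B_drop)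
    ultimately show ?thesis using 1(1) by blast
  qed
  then show ?case
    unfolding W using 1(2) by (subst moment_recursion) (fastforce simp: W intro!: sum.neutral)+
qed

subsection \<open>Height-dependent gauge twists\<close>

text \<open>A word is read from the left, starting at height \<open>h\<close>; each \<open>T\<close> lowers the height by \<open>1\<close> and each
  \<open>star T\<close> raises it. The index of \<open>d\<close> is the lower of the two heights next to the letter, so that
  letters crossing the same interval get adjoint factors.\<close>

definition twist_letter :: "(int \<Rightarrow> 'a) \<Rightarrow> int \<Rightarrow> 'a letter \<Rightarrow> 'a letter" where
  "twist_letter d h x = (if starred x then Letter True (lcoef x) (star (d h) * rcoef x)
     else Letter False (lcoef x * d (h - 1)) (rcoef x))"

fun twist :: "(int \<Rightarrow> 'a) \<Rightarrow> int \<Rightarrow> 'a letter list \<Rightarrow> 'a letter list" where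
  "twist d h [] = []"
| "twist d h (x # L) = twist_letter d h x # twist d (h - letter_degree x) L"

definition unitary_in_B :: "'a \<Rightarrow> bool" where
  "unitary_in_B u \<longleftrightarrow> u \<in> B \<and> star u * u = 1"

lemma starred_twist_letter [simp]: "starred (twist_letter d h x) = starred x"
  by (simp add: twist_letter_def)

lemma length_twist [simp]: "length (twist d h L) = length L"
  by (induction L arbitrary: h) auto

lemma twist_append [simp]: "twist d h (L @ M) = twist d h L @ twist d (h - word_degree L) M"
  by (induction L arbitrary: h) (auto simp: algebra_simps)

lemma take_twist: "take m (twist d h L) = twist d h (take m L)"
  by (induction L arbitrary: h m) (auto simp: take_Cons split: nat.split)

lemma drop_twist: "drop m (twist d h L) = twist d (h - word_degree (take m L)) (drop m L)"
  by (induction L arbitrary: h m) (auto simp: take_Cons drop_Cons algebra_simps split: nat.split)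

lemma nth_twist: "m < length L \<Longrightarrow> twist d h L ! m = twist_letter d (h - word_degree (take m L)) (L ! m)"
proof (induction L arbitrary: h m)
  case (Cons x L)
  then show ?case by (cases m) (auto simp: algebra_simps)
qed simp

lemma coefs_in_B_twist:
  assumes "coefs_in_B L" "\<And>h. unitary_in_B (d h)"
  shows "coefs_in_B (twist d h L)"
  using assms(1)
  by (induction L arbitrary: h)
    (use assms(2) in \<open>auto simp: twist_letter_def unitary_in_B_def intro!: B_closed\<close>)

text \<open>In a nonzero term of the moment formula the subword between the paired letters is balanced. The
  two letters then cross the same interval of heights and carry \<open>d k\<close> and \<open>star (d k)\<close>. These
  multiply either the argument of the covariance or its value, hence cancel, as \<open>B\<close> is
  commutative.\<close>

lemma E_word_twist:
  assumes "coefs_in_B L" and d: "\<And>h. unitary_in_B (d h)"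
  shows "E (word_value (twist d h L)) = E (word_value L)"
  using assms(1)
proof (induction L arbitrary: h rule: length_induct)
  case (1 W)
  show ?case
  proof (cases W)
    case (Cons x L)
    have dB: "d k \<in> B" "star (d k) \<in> B" and dd: "star (d k) * d k = 1" "d k * star (d k) = 1" for k
      using d[of k] by (auto simp: unitary_in_B_def B_closed B_commute)
    let ?h = "h - letter_degree x"
    define M where "M = twist d ?h L"
    define x' where "x' = twist_letter d h x"
    have ok: "coefs_in_B (x # L)" using 1(2) Cons by simp
    have ok': "coefs_in_B (x' # M)"
      using coefs_in_B_twist[where d = d and h = h, OF ok d] by (simp add: M_def x'_def)
    have st: "starred x' = starred x" "\<And>m. m < length L \<Longrightarrow> starred (M ! m) = starred (L ! m)"
      by (auto simp: x'_def M_def nth_twist)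
    have "E (word_value (x' # M)) = E (word_value (x # L))"
      unfolding moment_recursion[OF ok] moment_recursion[OF ok']
    proof (rule sum.cong)
      show "{m. m < length M \<and> starred (M ! m) \<noteq> starred x'} = {m. m < length L \<and> starred (L ! m) \<noteq> starred x}"
        using st by (auto simp: M_def)
      fix m assume "m \<in> {m. m < length L \<and> starred (L ! m) \<noteq> starred x}"
      then have m: "m < length L" "starred (L ! m) \<noteq> starred x" by auto
      define X where "X = E (word_value (take m L))"
      define Y where "Y = E (word_value (drop (Suc m) L))"
      have XY: "X \<in> B" "Y \<in> B" by (simp_all add: X_def Y_def)
      have IH: "E (word_value (twist d k (take m L))) = X" "E (word_value (twist d k (drop (Suc m) L))) = Y" for k
      proof -
        have "length (take m L) < length W" "length (drop (Suc m) L) < length W"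
          using m by (auto simp: Cons)
        moreover have "coefs_in_B (take m L)" "coefs_in_B (drop (Suc m) L)"
          using ok by (auto intro: coefs_in_B_take coefs_in_B_drop)
        ultimately show "E (word_value (twist d k (take m L))) = X" "E (word_value (twist d k (drop (Suc m) L))) = Y"
          using 1(1) unfolding X_def Y_def by blast+
      qed
      have co: "lcoef x \<in> B" "rcoef x \<in> B" "lcoef (L ! m) \<in> B" "rcoef (L ! m) \<in> B"
        using ok coefs_in_B_nth[of L m] m by auto
      have eqX: "E (word_value (take m M)) = X" and eqY: "E (word_value (drop (Suc m) M)) = Y"
        by (simp_all only: M_def take_twist drop_twist IH)
      show "lcoef x' * cov E T (starred x') (rcoef x' * E (word_value (take m M)) * lcoef (M ! m)) *
         rcoef (M ! m) * E (word_value (drop (Suc m) M)) =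
         lcoef x * cov E T (starred x) (rcoef x * E (word_value (take m L)) * lcoef (L ! m)) *
         rcoef (L ! m) * E (word_value (drop (Suc m) L))"
      proof (cases "word_degree (take m L) = 0")
        case False
        then have "X = 0" unfolding X_def using ok by (intro E_word_unbalanced coefs_in_B_take) auto
        then show ?thesis unfolding eqX eqY X_def[symmetric] by simp
      next
        case True
        then have Mm: "M ! m = twist_letter d ?h (L ! m)" using m by (simp add: M_def nth_twist)
        show ?thesis
        proof (cases "starred x")
          case True
          then have v: "lcoef x' = lcoef x" "rcoef x' = star (d h) * rcoef x" "starred x' = starred x"
            "lcoef (M ! m) = lcoef (L ! m) * d h" "rcoef (M ! m) = rcoef (L ! m)"
            using m by (auto simp: x'_def Mm twist_letter_def letter_degree_def)
          have "star (d h) * rcoef x * X * (lcoef (L ! m) * d h) = rcoef x * X * lcoef (L ! m)"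
          proof -
            have "star (d h) * rcoef x * X * (lcoef (L ! m) * d h) = star (d h) * (rcoef x * X * lcoef (L ! m) * d h)"
              by (simp only: mult.assoc)
            also have "rcoef x * X * lcoef (L ! m) * d h = d h * (rcoef x * X * lcoef (L ! m))"
              using co XY dB by (intro B_commute B_closed)
            finally show ?thesis using dd by (simp flip: mult.assoc)
          qed
          then show ?thesis unfolding eqX eqY X_def[symmetric] Y_def[symmetric] v by (simp only:)
        next
          case False
          then have v: "lcoef x' = lcoef x * d (h - 1)" "rcoef x' = rcoef x" "starred x' = starred x"
            "lcoef (M ! m) = lcoef (L ! m)" "rcoef (M ! m) = star (d (h - 1)) * rcoef (L ! m)"
            using m by (auto simp: x'_def Mm twist_letter_def letter_degree_def)
          have "lcoef x * d (h - 1) * C * (star (d (h - 1)) * rcoef (L ! m)) = lcoef x * C * rcoef (L ! m)"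
            if C: "C \<in> B" for C
          proof -
            have "d (h - 1) * C = C * d (h - 1)" using C dB by (intro B_commute)
            then have "lcoef x * d (h - 1) * C * (star (d (h - 1)) * rcoef (L ! m)) =
                lcoef x * C * (d (h - 1) * star (d (h - 1))) * rcoef (L ! m)"
              by (simp only: mult.assoc)
            then show ?thesis using dd by simp
          qed
          then show ?thesis unfolding eqX eqY X_def[symmetric] Y_def[symmetric] v by simp
        qed
      qed
    qed
    then show ?thesis by (simp add: Cons x'_def M_def)
  qed simp
qed

subsection \<open>Twists of polynomials\<close>

lemma word_absorb_right:
  assumes "coefs_in_B L" "L \<noteq> []" "b \<in> B"
  obtains L' where "coefs_in_B L'" "word_degree L' = word_degree L" "word_value L' = word_value L * b"
    "\<And>d h. word_value (twist d h L') = word_value (twist d h L) * b"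
proof -
  obtain M x where L: "L = M @ [x]" using assms(2) by (cases L rule: rev_cases) auto
  let ?y = "Letter (starred x) (lcoef x) (rcoef x * b)"
  show thesis
  proof
    show "coefs_in_B (M @ [?y])" using assms by (auto simp: L B_closed)
    show "word_degree (M @ [?y]) = word_degree L" by (simp add: L letter_degree_def)
    show "word_value (M @ [?y]) = word_value L * b" by (simp add: L letter_value_def mult.assoc)
    show "word_value (twist d h (M @ [?y])) = word_value (twist d h L) * b" for d h
      by (simp add: L letter_value_def twist_letter_def mult.assoc)
  qed
qed

text \<open>Twists are defined on words, not on elements, and an element may be spelled in several ways.
  They are therefore handled as relations between an element and its twist. The present relation
  is a normal form, spans of words with left height \<open>h\<close> and right height \<open>k\<close>, to which the
  lemmas on words apply.\<close>

inductive word_span_pair :: "(int \<Rightarrow> 'a) \<Rightarrow> int \<Rightarrow> int \<Rightarrow> 'a \<Rightarrow> 'a \<Rightarrow> bool" for d h k where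
  zero: "word_span_pair d h k 0 0"
| add: "b \<in> B \<Longrightarrow> coefs_in_B L \<Longrightarrow> word_degree L = h - k \<Longrightarrow> word_span_pair d h k x x' \<Longrightarrow>
    word_span_pair d h k (b * word_value L + x) (b * word_value (twist d h L) + x')"

lemma word_span_pair_word:
  assumes "b \<in> B" "coefs_in_B L" "word_degree L = h - k"
  shows "word_span_pair d h k (b * word_value L) (b * word_value (twist d h L))"
  using word_span_pair.add[OF assms word_span_pair.zero] by simp

lemma word_span_pair_add:
  assumes "word_span_pair d h k x x'" "word_span_pair d h k y y'"
  shows "word_span_pair d h k (x + y) (x' + y')"
  using assms(1) by induction (auto simp: assms(2) add.assoc intro: word_span_pair.add)

lemma word_span_pair_word_mult:
  assumes "word_span_pair d k l y y'" and b: "b \<in> B" and L: "coefs_in_B L" "word_degree L = h - k"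
  shows "word_span_pair d h l (b * word_value L * y) (b * word_value (twist d h L) * y')"
  using assms(1)
proof induction
  case zero
  then show ?case by (simp add: word_span_pair.zero)
next
  case (add b' L' y y')
  have hk: "h - word_degree L = k" using L(2) by simp
  have "word_span_pair d h l (b * word_value L * (b' * word_value L'))
      (b * word_value (twist d h L) * (b' * word_value (twist d k L')))"
  proof (cases "L = []")
    case True
    then have "h = k" using L by simp
    then show ?thesis
      using word_span_pair_word[of "b * b'" L' h l d] add.hyps True b B_closed by (simp add: mult.assoc)
  next
    case False
    obtain M where M: "coefs_in_B M" "word_degree M = word_degree L" "word_value M = word_value L * b'"
      "\<And>d h. word_value (twist d h M) = word_value (twist d h L) * b'"
      using word_absorb_right[OF L(1) False add.hyps(1)] by blast
    have "word_span_pair d h l (b * word_value (M @ L')) (b * word_value (twist d h (M @ L')))"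
      using add.hyps b M(1,2) L(2) by (intro word_span_pair_word) auto
    then show ?thesis using M(2,3,4) hk by (simp add: mult.assoc)
  qed
  from word_span_pair_add[OF this add.IH] show ?case by (simp add: distrib_left)
qed

lemma word_span_pair_mult:
  assumes "word_span_pair d h k x x'" "word_span_pair d k l y y'"
  shows "word_span_pair d h l (x * y) (x' * y')"
  using assms(1)
proof induction
  case zero
  then show ?case by (simp add: word_span_pair.zero)
next
  case (add b L x x')
  from word_span_pair_add[OF word_span_pair_word_mult[OF assms(2) add.hyps(1,2,3)] add.IH]
  show ?case by (simp add: distrib_right)
qed

lemma E_word_span_pair_unbalanced:
  assumes "word_span_pair d h k x x'" "h \<noteq> k"
  shows "E x = 0"
  using assms by induction (auto simp: E_add E_mult_left E_word_unbalanced)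

lemma E_word_span_pair:
  assumes "word_span_pair d h k x x'" "\<And>h. unitary_in_B (d h)"
  shows "E x' = E x"
  using assms(1) by induction (auto simp: E_add E_mult_left E_word_twist assms(2))

text \<open>A relation contained in the previous one, but generated by the algebra operations, which makes
  products and adjoints immediate.\<close>

inductive twisted :: "(int \<Rightarrow> 'a) \<Rightarrow> int \<Rightarrow> int \<Rightarrow> 'a \<Rightarrow> 'a \<Rightarrow> bool" for d where
  zero: "twisted d h k 0 0"
| coef: "b \<in> B \<Longrightarrow> twisted d h h b b"
| T: "twisted d (h + 1) h T (d h * T)"
| star_T: "twisted d h (h + 1) (star T) (star T * star (d h))"
| add: "twisted d h k x x' \<Longrightarrow> twisted d h k y y' \<Longrightarrow> twisted d h k (x + y) (x' + y')"
| mult: "twisted d h k x x' \<Longrightarrow> twisted d k l y y' \<Longrightarrow> twisted d h l (x * y) (x' * y')"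

lemma twisted_star: "twisted d h k x x' \<Longrightarrow> twisted d k h (star x) (star x')"
proof (induction rule: twisted.induct)
  case (T h)
  then show ?case using twisted.star_T[of d h] by (simp add: star_mult)
next
  case (star_T h)
  then show ?case using twisted.T[of d h] by (simp add: star_mult star_star)
qed (auto simp: star_add star_mult B_closed intro: twisted.intros)

lemma twisted_word_span_pair: "twisted d h k x x' \<Longrightarrow> word_span_pair d h k x x'"
proof (induction rule: twisted.induct)
  case (coef b h)
  then show ?case using word_span_pair_word[of b "[]" h h d] by simp
next
  case (T h)
  show ?case using word_span_pair_word[of 1 "[Letter False 1 1]" "h + 1" h d] B_closed(2)
    by (simp add: letter_degree_def letter_value_def twist_letter_def eps_power_def)
next
  case (star_T h)
  show ?case using word_span_pair_word[of 1 "[Letter True 1 1]" h "h + 1" d] B_closed(2)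
    by (simp add: letter_degree_def letter_value_def twist_letter_def eps_power_def)
qed (auto intro: word_span_pair.zero word_span_pair_add word_span_pair_mult)

lemma E_twisted_unbalanced: "twisted d h k x x' \<Longrightarrow> h \<noteq> k \<Longrightarrow> E x = 0"
  by (rule E_word_span_pair_unbalanced[OF twisted_word_span_pair])

lemma E_twisted: "twisted d h k x x' \<Longrightarrow> (\<And>h. unitary_in_B (d h)) \<Longrightarrow> E x' = E x"
  by (rule E_word_span_pair[OF twisted_word_span_pair])

subsection \<open>Homogeneous elements\<close>

inductive homogeneous :: "int \<Rightarrow> 'a \<Rightarrow> bool" where
  zero: "homogeneous m 0"
| coef: "b \<in> B \<Longrightarrow> homogeneous 0 b"
| T: "homogeneous 1 T"
| star_T: "homogeneous (-1) (star T)"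
| add: "homogeneous m x \<Longrightarrow> homogeneous m y \<Longrightarrow> homogeneous m (x + y)"
| mult: "homogeneous m x \<Longrightarrow> homogeneous n y \<Longrightarrow> homogeneous (m + n) (x * y)"

lemma homogeneous_twisted:
  assumes "homogeneous m x" shows "\<exists>x'. twisted d (h + m) h x x'"
  using assms
proof (induction arbitrary: h)
  case (star_T h)
  then show ?case using twisted.star_T[of d "h - 1"] by auto
next
  case (mult m x n y)
  have "\<exists>x'. twisted d (h + n + m) (h + n) x x'" "\<exists>y'. twisted d (h + n) h y y'"
    by (rule mult.IH)+
  then show ?case by (auto simp: add_ac intro: twisted.mult)
next
  case (add m x y)
  then obtain x' y' where "twisted d (h + m) h x x'" "twisted d (h + m) h y y'" by blast
  then show ?case by (blast intro: twisted.add)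
qed (auto simp: add.commute intro: twisted.intros)

lemma homogeneous_star: "homogeneous m x \<Longrightarrow> homogeneous (- m) (star x)"
proof (induction rule: homogeneous.induct)
  case (mult m x n y)
  then have "homogeneous (- n + - m) (star y * star x)" by (intro homogeneous.mult)
  moreover have "- n + - m = - (m + n)" by simp
  ultimately show ?case by (simp only: star_mult)
next
  case star_T
  then show ?case using homogeneous.T by (simp add: star_star)
next
  case (coef b)
  then show ?case using homogeneous.coef[of "star b"] by (simp add: B_closed)
qed (auto simp: star_add intro: homogeneous.intros)

lemma homogeneous_power: "homogeneous m x \<Longrightarrow> homogeneous (int n * m) (x ^ n)"
proof (induction n)
  case 0
  then show ?case using homogeneous.coef[OF B_closed(2)] by simp
next
  case (Suc n)
  then show ?case using homogeneous.mult[of m x "int n * m" "x ^ n"] by (simp add: algebra_simps)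
qed

lemma E_homogeneous: "homogeneous m x \<Longrightarrow> m \<noteq> 0 \<Longrightarrow> E x = 0"
  using homogeneous_twisted[of m x "\<lambda>_. 1" 0] E_twisted_unbalanced[of _ m 0] by auto

subsection \<open>Polynomials graded by degree\<close>

definition graded_span :: "int set \<Rightarrow> 'a set" where
  "graded_span Q = {x. \<exists>F f. finite F \<and> F \<subseteq> Q \<and> (\<forall>m. homogeneous m (f m)) \<and> x = sum f F}"

lemma graded_span_homogeneous:
  assumes "homogeneous m x" "m \<in> Q"
  shows "x \<in> graded_span Q"
proof -
  have "\<forall>k. homogeneous k (if k = m then x else 0)" using assms by (auto intro: homogeneous.zero)
  then show ?thesis using assms
    by (auto simp: graded_span_def intro!: exI[of _ "{m}"] exI[of _ "\<lambda>k. if k = m then x else 0"])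
qed

lemma graded_span_zero: "0 \<in> graded_span Q"
  by (auto simp: graded_span_def intro!: exI[of _ "{}"] exI[of _ "\<lambda>_. 0"] homogeneous.zero)

lemma graded_span_add:
  assumes "x \<in> graded_span Q" "y \<in> graded_span Q"
  shows "x + y \<in> graded_span Q"
proof -
  obtain F f where F: "finite F" "F \<subseteq> Q" "\<And>m. homogeneous m (f m)" "x = sum f F"
    using assms(1) by (auto simp: graded_span_def)
  obtain G g where G: "finite G" "G \<subseteq> Q" "\<And>m. homogeneous m (g m)" "y = sum g G"
    using assms(2) by (auto simp: graded_span_def)
  define k where "k m = (if m \<in> F then f m else 0) + (if m \<in> G then g m else 0)" for m
  have "homogeneous m (k m)" for m
    using F G by (auto simp: k_def intro: homogeneous.intros)
  moreover have "x + y = sum k (F \<union> G)"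
  proof -
    have "sum f F = (\<Sum>m\<in>F \<union> G. if m \<in> F then f m else 0)"
      using F(1) G(1) by (intro sum.mono_neutral_cong_left) auto
    moreover have "sum g G = (\<Sum>m\<in>F \<union> G. if m \<in> G then g m else 0)"
      using F(1) G(1) by (intro sum.mono_neutral_cong_left) auto
    ultimately show ?thesis by (simp add: F(4) G(4) k_def sum.distrib)
  qed
  ultimately show ?thesis using F(1,2) G(1,2)
    unfolding graded_span_def by (intro CollectI exI[of _ "F \<union> G"] exI[of _ k]) auto
qed

lemma graded_span_sum: "(\<And>i. i \<in> I \<Longrightarrow> f i \<in> graded_span Q) \<Longrightarrow> sum f I \<in> graded_span Q"
  by (induction I rule: infinite_finite_induct) (auto intro: graded_span_zero graded_span_add)

lemma graded_span_mult:
  assumes "x \<in> graded_span Q" "y \<in> graded_span R" "\<And>m n. m \<in> Q \<Longrightarrow> n \<in> R \<Longrightarrow> m + n \<in> P"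
  shows "x * y \<in> graded_span P"
proof -
  obtain F f where F: "finite F" "F \<subseteq> Q" "\<And>m. homogeneous m (f m)" "x = sum f F"
    using assms(1) by (auto simp: graded_span_def)
  obtain G g where G: "finite G" "G \<subseteq> R" "\<And>m. homogeneous m (g m)" "y = sum g G"
    using assms(2) by (auto simp: graded_span_def)
  have "f m * g n \<in> graded_span P" if "m \<in> F" "n \<in> G" for m n
    using that F G by (intro graded_span_homogeneous[of "m + n"] homogeneous.mult assms(3)) auto
  then show ?thesis unfolding F(4) G(4) sum_product by (intro graded_span_sum) auto
qed

lemma graded_span_star:
  assumes "x \<in> graded_span UNIV" shows "star x \<in> graded_span UNIV"
proof -
  obtain F f where F: "\<And>m. homogeneous m (f m)" "x = sum f F"
    using assms by (auto simp: graded_span_def)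
  have "star x = (\<Sum>m\<in>F. star (f m))"
    unfolding F(2) by (rule bounded_linear.linear[OF bounded_linear_star, THEN linear_sum])
  then show ?thesis
    using homogeneous_star[OF F(1)] by (auto intro!: graded_span_sum graded_span_homogeneous)
qed

lemma coef_in_graded_span: "b \<in> B \<Longrightarrow> 0 \<in> Q \<Longrightarrow> b \<in> graded_span Q"
  by (rule graded_span_homogeneous[OF homogeneous.coef])

lemma generated_subset_closure: "cstar_generated (insert T B) \<subseteq> closure (graded_span UNIV)"
proof (rule cstar_generated_minimal)
  have scale: "c *\<^sub>C x \<in> graded_span UNIV" if "x \<in> graded_span UNIV" for c x
    using graded_span_mult[OF coef_in_graded_span[of "c *\<^sub>C 1" UNIV] that, of UNIV] B_closed
    by (simp add: scaleC_mult_left)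
  show "unital_cstar_subalgebra (closure (graded_span UNIV))"
    unfolding unital_cstar_subalgebra_def
  proof (intro conjI ballI allI)
    show "1 \<in> closure (graded_span UNIV)"
      using coef_in_graded_span[OF B_closed(2), of UNIV] closure_subset by blast
    fix x y assume xy: "x \<in> closure (graded_span UNIV)" "y \<in> closure (graded_span UNIV)"
    show "x + y \<in> closure (graded_span UNIV)"
      by (rule closure_add_mem[OF xy graded_span_add])
    show "x * y \<in> closure (graded_span UNIV)"
      by (rule closure_mult_mem[OF xy graded_span_mult]) auto
  next
    fix x assume x: "x \<in> closure (graded_span UNIV)"
    show "star x \<in> closure (graded_span UNIV)"
      by (rule closure_bounded_linear_mem[OF bounded_linear_star x graded_span_star])
    show "c *\<^sub>C x \<in> closure (graded_span UNIV)" for c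
      by (rule closure_bounded_linear_mem[OF bounded_linear_scaleC x scale])
  qed simp
  show "insert T B \<subseteq> closure (graded_span UNIV)"
    using coef_in_graded_span[of _ UNIV] graded_span_homogeneous[OF homogeneous.T, of UNIV] closure_subset
    by blast
qed

section \<open>Norms of twisted powers\<close>

text \<open>For coefficients \<open>c\<^sub>1, \<dots>, c\<^sub>n\<close> this is \<open>c\<^sub>1 * T * c\<^sub>2 * T * \<dots> * c\<^sub>n * T\<close>.\<close>

definition coef_power :: "'a list \<Rightarrow> 'a" where
  "coef_power cs = prod_list (map (\<lambda>c. c * T) cs)"

lemma coef_power_simps [simp]:
  "coef_power [] = 1" "coef_power (c # cs) = c * T * coef_power cs"
  "coef_power (cs @ cs') = coef_power cs * coef_power cs'"
  by (simp_all add: coef_power_def)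

lemma coef_power_replicate: "coef_power (replicate n c) = (c * T) ^ n"
  by (induction n) simp_all

lemma unitary_in_BD:
  assumes "unitary_in_B u"
  shows "u \<in> B" "star u * u = 1" "u * star u = 1" "unitary_in_B (star u)"
  using assms B_commute[of u "star u"] by (auto simp: unitary_in_B_def B_closed star_star)

lemma homogeneous_coef_power: "set cs \<subseteq> B \<Longrightarrow> homogeneous (int (length cs)) (coef_power cs)"
proof (induction cs)
  case Nil
  then show ?case using homogeneous.coef[OF B_closed(2)] by simp
next
  case (Cons c cs)
  then have "homogeneous (0 + 1 + int (length cs)) (c * T * coef_power cs)"
    by (intro homogeneous.mult homogeneous.T homogeneous.coef) auto
  then show ?case by (simp add: add.commute)
qed

text \<open>Twisting by the adjoints of the coefficients removes them. The rightmost \<open>T\<close> sits at the lowest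
  height, whence the reversal.\<close>

lemma twisted_coef_power:
  assumes "\<forall>c\<in>set cs. unitary_in_B c" "\<And>j. j < length cs \<Longrightarrow> d (h + int j) = star (rev cs ! j)"
  shows "twisted d (h + int (length cs)) h (coef_power cs) (T ^ length cs)"
  using assms
proof (induction cs)
  case Nil
  then show ?case using twisted.coef[OF B_closed(2)] by simp
next
  case (Cons c cs)
  let ?k = "h + int (length cs)"
  have c: "unitary_in_B c" using Cons.prems by simp
  have "twisted d ?k h (coef_power cs) (T ^ length cs)"
  proof (rule Cons.IH)
    show "d (h + int j) = star (rev cs ! j)" if "j < length cs" for j
      using Cons.prems(2)[of j] that by (simp add: nth_append)
  qed (use Cons.prems in auto)
  moreover have "twisted d (?k + 1) ?k (c * T) (c * (d ?k * T))"
    by (rule twisted.mult[OF twisted.coef[OF unitary_in_BD(1)[OF c]] twisted.T])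
  moreover have "c * (d ?k * T) = T"
  proof -
    have "d ?k = star c" using Cons.prems(2)[of "length cs"] by (simp add: nth_append)
    then show ?thesis using unitary_in_BD(3)[OF c] by (simp flip: mult.assoc)
  qed
  ultimately have "twisted d (?k + 1) h (c * T * coef_power cs) (T * T ^ length cs)"
    by (metis twisted.mult)
  then show ?case by (simp add: algebra_simps)
qed

text \<open>For \<open>x\<close> of degree \<open>m\<close>, a twist that is nontrivial only at the heights \<open>m, \<dots>, m + n - 1\<close> turns
  \<open>p * x\<close> into \<open>u * x'\<close> and \<open>x\<close> into \<open>x'\<close> without changing their norms in \<open>L\<^sup>2(E)\<close>. The absolute square
  \<open>p\<close> is used in place of \<open>coef_power cs\<close> because the step from \<open>L\<^sup>2(E)\<close> to the norm of the algebra is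
  made for selfadjoint elements.\<close>

lemma L2_bound_homogeneous:
  assumes cs: "\<forall>c\<in>set cs. unitary_in_B c" and x: "homogeneous m x"
  defines "p \<equiv> star (coef_power cs) * coef_power cs"
    and "u \<equiv> star (T ^ length cs) * T ^ length cs"
  shows "positive ((norm u)\<^sup>2 *\<^sub>R E (star x * x) - E (star (p * x) * (p * x)))"
proof -
  define n where "n = length cs"
  define d where "d k = (if m \<le> k \<and> k < m + int n then star (rev cs ! nat (k - m)) else 1)" for k
  have d: "unitary_in_B (d k)" for k
  proof (cases "m \<le> k \<and> k < m + int n")
    case True
    then have "rev cs ! nat (k - m) \<in> set (rev cs)" by (intro nth_mem) (auto simp: n_def)
    then show ?thesis using True cs unitary_in_BD(4) by (simp add: d_def)
  qed (auto simp: d_def unitary_in_B_def B_closed)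
  have V: "twisted d (m + int n) m (coef_power cs) (T ^ n)"
    unfolding n_def by (rule twisted_coef_power[OF cs]) (simp add: d_def n_def)
  have p: "twisted d m m p u"
    unfolding p_def u_def n_def[symmetric] by (rule twisted.mult[OF twisted_star[OF V] V])
  obtain x' where x': "twisted d m 0 x x'" using homogeneous_twisted[OF x, of d 0] by auto
  have px: "twisted d m 0 (p * x) (u * x')" by (rule twisted.mult[OF p x'])
  have "E (star (u * x') * (u * x')) = E (star (p * x) * (p * x))"
    by (rule E_twisted[OF twisted.mult[OF twisted_star[OF px] px] d])
  moreover have "E (star x' * x') = E (star x * x)"
    by (rule E_twisted[OF twisted.mult[OF twisted_star[OF x'] x'] d])
  ultimately show ?thesis using L2_operator_bound[of u x'] by simp
qed

lemma E_star_mult_graded: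
  assumes F: "finite F" and f: "\<And>m. homogeneous m (f m)"
  shows "E (star (sum f F) * sum f F) = (\<Sum>m\<in>F. E (star (f m) * f m))"
proof -
  have off: "E (star (f m) * f n) = 0" if "m \<noteq> n" for m n
    by (rule E_homogeneous[OF homogeneous.mult[OF homogeneous_star[OF f] f]]) (use that in simp)
  have "star (sum f F) = (\<Sum>m\<in>F. star (f m))"
    by (rule bounded_linear.linear[OF bounded_linear_star, THEN linear_sum])
  then have "E (star (sum f F) * sum f F) = (\<Sum>m\<in>F. \<Sum>n\<in>F. E (star (f m) * f n))"
    by (simp add: sum_product E_sum)
  also have "\<dots> = (\<Sum>m\<in>F. \<Sum>n\<in>F. if n = m then E (star (f m) * f m) else 0)"
    by (intro sum.cong refl) (auto simp: off)
  also have "\<dots> = (\<Sum>m\<in>F. E (star (f m) * f m))" using F by simp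
  finally show ?thesis .
qed

text \<open>The twist behind \<open>L2_bound_homogeneous\<close> depends on the degree \<open>m\<close>, but \<open>p\<close> preserves degrees and distinct
  degrees are orthogonal. The bounds on the homogeneous parts thus add up to one on all polynomials
  and, by continuity, on the generated algebra.\<close>

lemma norm_coef_power_unitary_le:
  assumes faithful: "gns_faithful_on (cstar_generated (insert T B)) E"
    and cs: "\<forall>c\<in>set cs. unitary_in_B c"
  shows "norm (coef_power cs) \<le> norm (T ^ length cs)"
proof -
  let ?D = "cstar_generated (insert T B)"
  define p where "p = star (coef_power cs) * coef_power cs"
  define u where "u = star (T ^ length cs) * T ^ length cs"
  define gap where "gap x = (norm u)\<^sup>2 *\<^sub>R E (star x * x) - E (star (p * x) * (p * x))" for x
  note D = cstar_generated_subalgebra[of "insert T B"]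
  note Dd = cstar_subalgebraD[OF D]
  have csB: "set cs \<subseteq> B" using cs unitary_in_BD(1) by auto
  have TD: "T \<in> ?D" "B \<subseteq> ?D" using cstar_generated_superset[of "insert T B"] by auto
  have "coef_power cs \<in> ?D" using csB
  proof (induction cs)
    case Nil
    then show ?case using Dd(2) by simp
  next
    case (Cons c cs)
    then show ?case using TD by (auto intro!: Dd(5))
  qed
  then have pD: "p \<in> ?D" by (auto simp: p_def intro: Dd)
  have psa: "star p = p" by (simp add: p_def star_mult star_star)
  have "homogeneous (- int (length cs) + int (length cs)) p"
    unfolding p_def by (intro homogeneous.mult homogeneous_star homogeneous_coef_power csB)
  then have p0: "homogeneous 0 p" by simp
  have span: "positive (gap x)" if x: "x \<in> graded_span UNIV" for x
  proof -
    obtain F f where F: "finite F" "\<And>m. homogeneous m (f m)" "x = sum f F"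
      using x by (auto simp: graded_span_def)
    have pf: "homogeneous m (p * f m)" for m
      using homogeneous.mult[OF p0 F(2)[of m]] by simp
    have px: "p * x = (\<Sum>m\<in>F. p * f m)" by (simp add: F(3) sum_distrib_left)
    have "gap x = (\<Sum>m\<in>F. gap (f m))"
      unfolding gap_def px E_star_mult_graded[OF F(1) pf]
      unfolding F(3) E_star_mult_graded[OF F(1,2)]
      by (simp add: scaleR_sum_right sum_subtractf)
    moreover have "positive (gap (f m))" for m
      unfolding gap_def p_def u_def by (rule L2_bound_homogeneous[OF cs F(2)])
    ultimately show ?thesis by (simp add: positive_sum)
  qed
  have "positive (gap x)" if "x \<in> ?D" for x
  proof -
    have "x \<in> closure (graded_span UNIV)" using that generated_subset_closure by blast
    then obtain s where s: "\<And>n. s n \<in> graded_span UNIV" "s \<longlonglongrightarrow> x"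
      by (auto simp: closure_sequential)
    have "(\<lambda>n. gap (s n)) \<longlonglongrightarrow> gap x"
      unfolding gap_def
      by (intro tendsto_intros bounded_linear.tendsto[OF bounded_linear_E]
          bounded_linear.tendsto[OF bounded_linear_star] s(2))
    then have "gap x \<in> {x. positive x}"
      using closed_sequentially[OF closed_positive, of "\<lambda>n. gap (s n)"] span s(1) by blast
    then show ?thesis by simp
  qed
  then have "(norm p)\<^sup>2 \<le> (norm u)\<^sup>2"
    unfolding gap_def by (intro norm_le_of_L2_operator_bound[OF D faithful pD psa]) auto
  then have "norm p \<le> norm u" by (simp add: power2_le_iff_abs_le)
  then show ?thesis unfolding p_def u_def cstar_identity by (simp add: power2_le_iff_abs_le)
qed

text \<open>A selfadjoint contraction \<open>z\<close> is the real part of the unitary \<open>z + \<i> *\<^sub>C sqrt (1 - z * z)\<close>.\<close>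

lemma selfadjoint_sum_of_unitaries:
  assumes z: "z \<in> B" "star z = z" "norm z \<le> 1"
  obtains u v where "unitary_in_B u" "unitary_in_B v" "z = (1/2) *\<^sub>R (u + v)"
proof -
  have "norm (z * z) \<le> 1"
    using norm_square_of_selfadjoint[OF z(2)] z(3) by (simp add: power_le_one)
  then have n: "norm (1 - (1 - z * z)) \<le> 1" by simp
  have zz: "1 - z * z \<in> B" "star (1 - z * z) = 1 - z * z"
    using z by (auto simp: B_closed star_diff star_mult)
  obtain s where s: "s \<in> B" "star s = s" "s * s = 1 - z * z"
    by (rule cstar_sqrt_exists[OF B_subalgebra zz n]) blast
  define u where "u = z + \<i> *\<^sub>C s"
  have "star u * u = z * z + s * s"
    unfolding u_def using z s B_commute by (intro abs_square_of_commuting_parts) auto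
  then have u: "unitary_in_B u" using s z by (auto simp: unitary_in_B_def u_def B_closed)
  have "u + star u = (z + z) + (\<i> *\<^sub>C s + (-\<i>) *\<^sub>C s)"
    unfolding u_def star_of_complex_combination[OF z(2) s(2)] by (simp only: add_ac)
  then have "z = (1/2) *\<^sub>R (u + star u)" unfolding i_scaleC_cancel by (simp flip: scaleR_2)
  with u unitary_in_BD(4)[OF u] show thesis by (rule that)
qed

lemma sum_of_four_unitaries:
  assumes c: "c \<in> B"
  obtains us where "length us = 4" "\<forall>u\<in>set us. unitary_in_B u" "c = (norm c / 2) *\<^sub>R sum_list us"
proof (cases "c = 0")
  case True
  have "\<forall>u\<in>set (replicate 4 1). unitary_in_B u" by (simp add: unitary_in_B_def B_closed)
  then show thesis using True that[of "replicate 4 1"] by simp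
next
  case False
  define a where "a = (1 / norm c) *\<^sub>R c"
  have a: "a \<in> B" "norm a = 1" using c False by (simp_all add: a_def B_closed)
  obtain x y where xy: "star x = x" "star y = y" "a = x + \<i> *\<^sub>C y"
    "x = (1/2) *\<^sub>R (a + star a)" "y = (1/2) *\<^sub>R (- \<i> *\<^sub>C (a - star a))"
    by (rule real_imaginary_parts)
  have xyB: "x \<in> B" "y \<in> B" unfolding xy(4,5) using a(1) by (auto intro!: B_closed)
  have nx: "norm x \<le> 1" using norm_real_part_le[OF xy(1,2)] a(2) by (simp flip: xy(3))
  have "norm y = 1/2 * norm (a - star a)"
    unfolding xy(5) by (simp add: norm_scaleC scaleC_minus_left)
  also have "\<dots> \<le> 1" using norm_triangle_ineq4[of a "star a"] a(2) by (simp add: norm_star)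
  finally have ny: "norm y \<le> 1" .
  obtain u v where uv: "unitary_in_B u" "unitary_in_B v" "x = (1/2) *\<^sub>R (u + v)"
    by (rule selfadjoint_sum_of_unitaries[OF xyB(1) xy(1) nx])
  obtain u' v' where uv': "unitary_in_B u'" "unitary_in_B v'" "y = (1/2) *\<^sub>R (u' + v')"
    by (rule selfadjoint_sum_of_unitaries[OF xyB(2) xy(2) ny])
  have iu: "unitary_in_B (\<i> *\<^sub>C w)" if "unitary_in_B w" for w
    using that by (auto simp: unitary_in_B_def B_closed star_scaleC scaleC_mult_left scaleC_mult_right scaleC_scaleC)
  have "\<i> *\<^sub>C y = (1/2) *\<^sub>R (\<i> *\<^sub>C u' + \<i> *\<^sub>C v')"
    unfolding uv'(3) by (simp add: scaleR_eq_scaleC scaleC_scaleC scaleC_add_right mult.commute)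
  then have "a = (1/2) *\<^sub>R (u + v + (\<i> *\<^sub>C u' + \<i> *\<^sub>C v'))"
    unfolding xy(3) uv(3) by (simp add: scaleR_add_right)
  moreover have "c = norm c *\<^sub>R a" using False by (simp add: a_def)
  ultimately have "c = norm c *\<^sub>R (1/2) *\<^sub>R (u + v + (\<i> *\<^sub>C u' + \<i> *\<^sub>C v'))" by simp
  then have "c = (norm c / 2) *\<^sub>R sum_list [u, v, \<i> *\<^sub>C u', \<i> *\<^sub>C v']"
    by (simp add: add_ac)
  moreover have "\<forall>w\<in>set [u, v, \<i> *\<^sub>C u', \<i> *\<^sub>C v']. unitary_in_B w"
    using uv uv' iu by simp
  ultimately show thesis by (intro that[of "[u, v, \<i> *\<^sub>C u', \<i> *\<^sub>C v']"]) auto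
qed

text \<open>By multilinearity the coefficients are replaced one after the other, from the right, by sums of
  four unitaries; each replacement costs a factor \<open>4 * (norm c / 2)\<close>.\<close>

lemma norm_coef_power_append_le:
  assumes faithful: "gns_faithful_on (cstar_generated (insert T B)) E"
    and "set cs \<subseteq> B" "\<forall>u\<in>set us. unitary_in_B u"
  shows "norm (coef_power (cs @ us)) \<le> prod_list (map (\<lambda>c. 2 * norm c) cs) * norm (T ^ length (cs @ us))"
  using assms(2,3)
proof (induction cs arbitrary: us rule: rev_induct)
  case Nil
  then show ?case using norm_coef_power_unitary_le[OF faithful] by simp
next
  case (snoc c cs)
  let ?K = "prod_list (map (\<lambda>c. 2 * norm c) cs) * norm (T ^ (Suc (length (cs @ us))))"
  have "c \<in> B" using snoc.prems by simp
  then obtain vs where vs: "length vs = 4" "\<forall>u\<in>set vs. unitary_in_B u" "c = (norm c / 2) *\<^sub>R sum_list vs"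
    by (rule sum_of_four_unitaries)
  have le: "norm (coef_power (cs @ v # us)) \<le> ?K" if "v \<in> set vs" for v
    using snoc.IH[of "v # us"] snoc.prems vs(2) that by simp
  have "norm (coef_power cs * sum_list ws * T * coef_power us) \<le> real (length ws) * ?K"
    if "set ws \<subseteq> set vs" for ws
    using that
  proof (induction ws)
    case (Cons w ws)
    have "norm (coef_power cs * sum_list (w # ws) * T * coef_power us) \<le>
        norm (coef_power (cs @ w # us)) + norm (coef_power cs * sum_list ws * T * coef_power us)"
      by (simp add: distrib_left distrib_right mult.assoc norm_triangle_ineq)
    also have "\<dots> \<le> ?K + real (length ws) * ?K"
      using Cons le by (intro add_mono) auto
    finally show ?case by (simp add: distrib_right)
  qed simp
  from this[of vs] have sum: "norm (coef_power cs * sum_list vs * T * coef_power us) \<le> 4 * ?K"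
    using vs(1) by simp
  have "coef_power ((cs @ [c]) @ us) = coef_power cs * ((norm c / 2) *\<^sub>R sum_list vs) * T * coef_power us"
    unfolding vs(3)[symmetric] by (simp add: mult.assoc)
  then have "norm (coef_power ((cs @ [c]) @ us)) = norm c / 2 * norm (coef_power cs * sum_list vs * T * coef_power us)"
    by simp
  also have "\<dots> \<le> norm c / 2 * (4 * ?K)" by (rule mult_left_mono[OF sum]) simp
  finally show ?case by (simp add: mult_ac)
qed

lemma norm_coef_mult_power_le:
  assumes "gns_faithful_on (cstar_generated (insert T B)) E" "c \<in> B"
  shows "norm ((c * T) ^ n) \<le> (2 * norm c) ^ n * norm (T ^ n)"
proof -
  have "set (replicate n c) \<subseteq> B" using assms(2) by auto
  from norm_coef_power_append_le[OF assms(1) this, of "[]"] show ?thesis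
    by (simp add: coef_power_replicate prod_list_replicate)
qed

section \<open>Upper triangular elements\<close>

definition upper_triangular :: "'a \<Rightarrow> bool" where
  "upper_triangular x \<longleftrightarrow> x - E x \<in> closure (graded_span {0<..})"

lemma E_closure_positive_degree:
  assumes "x \<in> closure (graded_span {0<..})"
  shows "E x = 0"
proof -
  have "E x \<in> closure {0}"
  proof (rule closure_bounded_linear_mem[OF bounded_linear_E assms])
    fix s assume "s \<in> graded_span {0<..}"
    then obtain F f where F: "F \<subseteq> {0<..}" "\<And>m. homogeneous m (f m)" "s = sum f F"
      by (auto simp: graded_span_def)
    have "E (f m) = 0" if "m \<in> F" for m
      using F(1) that by (intro E_homogeneous[OF F(2)[of m]]) auto
    then have "E s = 0" by (simp add: F(3) E_sum)
    then show "E s \<in> {0}" by simp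
  qed
  then show ?thesis by simp
qed

lemma upper_triangular_mult:
  assumes x: "upper_triangular x" and y: "upper_triangular y"
  shows "upper_triangular (x * y)" "E (x * y) = E x * E y"
proof -
  let ?I = "closure (graded_span {0<..})" and ?C = "graded_span {0}"
  define i where "i = x - E x"
  define j where "j = y - E y"
  have ij: "i \<in> ?I" "j \<in> ?I" using x y by (auto simp: upper_triangular_def i_def j_def)
  have E0: "E z \<in> closure ?C" for z
    using coef_in_graded_span[OF E_in_B, of "{0}"] closure_subset by blast
  have I: "E x * j + i * E y + i * j \<in> ?I"
  proof (intro closure_add_mem graded_span_add)
    show "E x * j \<in> ?I" by (rule closure_mult_mem[OF E0 ij(2) graded_span_mult]) auto
    show "i * E y \<in> ?I" by (rule closure_mult_mem[OF ij(1) E0 graded_span_mult]) auto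
    show "i * j \<in> ?I" by (rule closure_mult_mem[OF ij graded_span_mult]) auto
  qed
  have xy: "x * y = E x * E y + (E x * j + i * E y + i * j)"
    by (simp add: i_def j_def algebra_simps)
  have "E (x * y) = E (E x * E y) + E (E x * j + i * E y + i * j)"
    by (subst xy) (rule E_add)
  then show e: "E (x * y) = E x * E y"
    by (simp add: E_closure_positive_degree[OF I] E_of_B B_closed)
  have "x * y - E (x * y) = E x * j + i * E y + i * j"
    unfolding e by (subst xy) simp
  then show "upper_triangular (x * y)" using I by (simp add: upper_triangular_def)
qed

lemma upper_triangular_power:
  assumes "upper_triangular x"
  shows "upper_triangular (x ^ n)" "E (x ^ n) = E x ^ n"
proof (induction n)
  case 0
  show "upper_triangular (x ^ 0)" "E (x ^ 0) = E x ^ 0"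
    using closure_subset[of "graded_span {0<..}"] graded_span_zero by (auto simp: upper_triangular_def)
next
  case (Suc n)
  show "upper_triangular (x ^ Suc n)" "E (x ^ Suc n) = E x ^ Suc n"
    using upper_triangular_mult[OF assms Suc(1)] Suc(2) by simp_all
qed

text \<open>The Schwarz inequality for \<open>E\<close>: the difference of the two sides is
  \<open>E (star (x - E x) * (x - E x))\<close>.\<close>

lemma E_abs_square_ge: "le_in B (star (E x) * E x) (E (star x * x))"
proof -
  have "star (x - E x) * (x - E x) = star x * x - star x * E x - star (E x) * x + star (E x) * E x"
    by (simp add: star_diff algebra_simps)
  then have "E (star (x - E x) * (x - E x)) = E (star x * x) - star (E x) * E x"
    by (simp add: E_add E_diff E_mult_left E_mult_right E_star B_closed E_of_B)
  then show ?thesis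
    using E_le[of "x - E x"] by (auto simp: le_in_def B_closed)
qed

lemma upper_triangular_power_ge:
  assumes "upper_triangular x"
  shows "le_in B (star (E x ^ n) * E x ^ n) (E (star (x ^ n) * x ^ n))"
  using E_abs_square_ge[of "x ^ n"] upper_triangular_power(2)[OF assms] by simp

end

section \<open>Shifts of a quasinilpotent circular element\<close>

theorem lemma5p4:
  fixes B :: "'a::cstar_algebra set" and E :: "'a \<Rightarrow> 'a" and T b Z :: 'a
  assumes "cstar_ncps B E"
    and "\<forall>x\<in>B. \<forall>y\<in>B. x * y = y * x"
    and "gns_faithful_on (cstar_generated (insert T B)) E"
    and "B_circular B E T"
    and "quasinilpotent T"
    and "invertible_in B b"
    and "Z = b + T"
  shows "invertible_in UNIV Z \<and>
    (\<forall>n. le_in B (star (b ^ n) * b ^ n) (E (star (Z ^ n) * Z ^ n))) \<and>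
    (\<forall>n. le_in B (star (ring_inv b ^ n) * ring_inv b ^ n)
                  (E (star (ring_inv Z ^ n) * ring_inv Z ^ n)))"
proof -
  interpret circular B E T
    using assms(1,2,4) by unfold_locales auto
  obtain b' where b: "b \<in> B" "b' \<in> B" "b * b' = 1" "b' * b = 1"
    using assms(6) by (auto simp: invertible_in_def)
  define s where "s = (- b') * T"
  define y where "y = (\<Sum>n. s ^ n)"
  define Z' where "Z' = y * b'"
  have sum: "summable (\<lambda>n. norm (s ^ n))"
  proof (rule summable_comparison_test'[of "\<lambda>n. (2 * norm b') ^ n * norm (T ^ n)" 0])
    show "summable (\<lambda>n. (2 * norm b') ^ n * norm (T ^ n))"
      by (rule quasinilpotent_summable[OF assms(5)]) simp
    show "norm (norm (s ^ n)) \<le> (2 * norm b') ^ n * norm (T ^ n)" for n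
      using norm_coef_mult_power_le[OF assms(3), of "- b'" n] b(2) by (simp add: s_def B_closed)
  qed
  have Zs: "Z = b * (1 - s)"
    using b by (simp add: assms(7) s_def distrib_left flip: mult.assoc)
  have y: "(1 - s) * y = 1" "y * (1 - s) = 1"
    unfolding y_def by (rule neumann_series_inverse[OF sum])+
  have "Z * Z' = b * ((1 - s) * y) * b'" by (simp only: Zs Z'_def mult.assoc)
  then have ZZ': "Z * Z' = 1" using y b by simp
  have "Z' * Z = y * (b' * b) * (1 - s)" by (simp only: Zs Z'_def mult.assoc)
  then have Z'Z: "Z' * Z = 1" using y b by simp
  have "E T = 0" by (rule E_homogeneous[OF homogeneous.T]) simp
  then have EZ: "E Z = b" by (simp add: assms(7) E_add E_of_B b)
  have "T \<in> graded_span {0<..}" by (rule graded_span_homogeneous[OF homogeneous.T]) simp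
  then have Z: "upper_triangular Z"
    using closure_subset by (auto simp: upper_triangular_def EZ) (auto simp: assms(7))
  have sd: "s ^ Suc n * b' \<in> graded_span {0<..}" for n
  proof (rule graded_span_homogeneous)
    have "homogeneous 1 s"
      unfolding s_def using homogeneous.mult[OF homogeneous.coef homogeneous.T, of "- b'"] b(2)
      by (simp add: B_closed)
    then have "homogeneous (int (Suc n) * 1 + 0) (s ^ Suc n * b')"
      by (intro homogeneous.mult homogeneous_power homogeneous.coef b)
    then show "homogeneous (int (Suc n)) (s ^ Suc n * b')" by simp
  qed simp
  have "(\<lambda>n. s ^ n) sums y"
    unfolding y_def by (rule summable_sums[OF summable_norm_cancel[OF sum]])
  then have "(\<lambda>n. s ^ Suc n) sums (y - 1)" by (subst sums_Suc_iff) simp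
  then have "(\<lambda>n. s ^ Suc n * b') sums ((y - 1) * b')" by (rule sums_mult2)
  then have "(\<lambda>n. \<Sum>k<n. s ^ Suc k * b') \<longlonglongrightarrow> (y - 1) * b'" by (simp only: sums_def)
  moreover have "(\<Sum>k<n. s ^ Suc k * b') \<in> graded_span {0<..}" for n
    by (rule graded_span_sum) (rule sd)
  ultimately have "(y - 1) * b' \<in> closure (graded_span {0<..})"
    unfolding closure_sequential by (intro exI[of _ "\<lambda>n. \<Sum>k<n. s ^ Suc k * b'"]) blast
  then have diff: "Z' - b' \<in> closure (graded_span {0<..})"
    by (simp add: Z'_def left_diff_distrib)
  have "E Z' = b' + E (Z' - b')" using b by (simp add: E_diff E_of_B)
  then have EZ': "E Z' = b'" using E_closure_positive_degree[OF diff] by simp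
  have Z': "upper_triangular Z'" using diff by (simp add: upper_triangular_def EZ')
  have "invertible_in UNIV Z" using ZZ' Z'Z by (auto simp: invertible_in_def)
  moreover have "le_in B (star (b ^ n) * b ^ n) (E (star (Z ^ n) * Z ^ n))" for n
    using upper_triangular_power_ge[OF Z] by (simp add: EZ)
  moreover have "ring_inv b = b'" "ring_inv Z = Z'"
    using b ZZ' Z'Z by (auto intro: ring_inv_eqI)
  then have "le_in B (star (ring_inv b ^ n) * ring_inv b ^ n) (E (star (ring_inv Z ^ n) * ring_inv Z ^ n))" for n
    using upper_triangular_power_ge[OF Z'] by (simp add: EZ')
  ultimately show ?thesis by blast
qed

end
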